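(* Let $U$ be a compactly supported distribution in $\mathcal S'(\mathbb R^2)$. Then the function $$(x,y,t)\mapsto f_U(x+iy,t)=\big\langle U,\Phi_{(\cdot)}(x+iy,t)\big\rangle_{\mathbb R^2},\qquad x,y\in\mathbb R^n,\ t\in\mathbb R,$$ extends to a holomorphic function on $\mathbb C^{2n+1}$.
   Context: Let $n\ge1$. For $(\xi,\lambda)\in\mathbb C^2$ and $(z,t)\in H_n=\mathbb C^n\times\mathbb R$ (the Heisenberg group), the spherical function is $$\Phi_{\xi,\lambda}(z,t)=e^{i\lambda t}e^{-\lambda|z|^2/4}\Big(1+\sum_{k\ge1}\frac{|z|^{2k}}{(n)_k\,k!\,4^k}\prod_{d=0}^{k-1}\big(\lambda(2d+n)-\xi\big)\Big),\qquad (n)_k=n(n+1)\cdots(n+k-1).$$ $\Phi_{(\cdot)}(z,t)$ denotes the smooth function $(\xi,\lambda)\mapsto\Phi_{\xi,\lambda}(z,t)$ on $\mathbb R^2$, and $\langle\cdot,\cdot\rangle_{\mathbb R^2}$ is the bilinear pairing of a compactly supported distribution with a smooth function. *)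

theory Defs
  imports "HOL-Analysis.Analysis"
begin

section \<open>Smooth functions and Schwartz functions\<close>

primrec iter_deriv ::
    "'a::euclidean_space list \<Rightarrow> ('a \<Rightarrow> complex) \<Rightarrow> 'a \<Rightarrow> complex" where
  "iter_deriv [] f = f"
| "iter_deriv (b # bs) f = (\<lambda>x. frechet_derivative (iter_deriv bs f) (at x) b)"

text \<open>For a list of basis vectors, \<open>iter_deriv\<close> is an iterated partial derivative. Since
  \<open>frechet_derivative\<close> is total, smoothness requires all these derivatives to be genuinely
  differentiable; in particular they are all continuous.\<close>

definition smooth :: "('a::euclidean_space \<Rightarrow> complex) \<Rightarrow> bool" where
  "smooth f \<longleftrightarrow>
     (\<forall>bs x. set bs \<subseteq> Basis \<longrightarrow> iter_deriv bs f differentiable (at x))"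

definition test_function :: "('a::euclidean_space \<Rightarrow> complex) \<Rightarrow> bool" where
  "test_function f \<longleftrightarrow> smooth f \<and> compact (closure {x. f x \<noteq> 0})"

definition schwartz :: "('a::euclidean_space \<Rightarrow> complex) set" where
  "schwartz = {f. smooth f \<and>
     (\<forall>k bs. set bs \<subseteq> Basis \<longrightarrow>
        bdd_above (range (\<lambda>x. norm x ^ k * norm (iter_deriv bs f x))))}"

definition schwartz_seminorm ::
    "nat \<Rightarrow> 'a::euclidean_space list \<Rightarrow> ('a \<Rightarrow> complex) \<Rightarrow> real" where
  "schwartz_seminorm k bs f = (SUP x. norm x ^ k * norm (iter_deriv bs f x))"


section \<open>Tempered distributions and compact support\<close>

text \<open>A tempered distribution is a functional whose values matter on Schwartz functions only,
  where it is complex linear and continuous for the topology generated by the seminorms: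
  finitely many of them, all with indices bounded by some \<open>N\<close>, give a basic neighbourhood.\<close>

definition tempered_distribution ::
    "(('a::euclidean_space \<Rightarrow> complex) \<Rightarrow> complex) \<Rightarrow> bool" where
  "tempered_distribution U \<longleftrightarrow>
     (\<forall>f\<in>schwartz. \<forall>g\<in>schwartz. U (\<lambda>x. f x + g x) = U f + U g) \<and>
     (\<forall>c. \<forall>f\<in>schwartz. U (\<lambda>x. c * f x) = c * U f) \<and>
     (\<forall>f\<in>schwartz. \<forall>\<epsilon>>0. \<exists>N. \<exists>\<delta>>0. \<forall>g\<in>schwartz.
        (\<forall>k bs. k \<le> N \<and> length bs \<le> N \<and> set bs \<subseteq> Basis \<longrightarrow>
           schwartz_seminorm k bs (\<lambda>x. g x - f x) < \<delta>) \<longrightarrow>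
        norm (U g - U f) < \<epsilon>)"

definition dist_support ::
    "(('a::euclidean_space \<Rightarrow> complex) \<Rightarrow> complex) \<Rightarrow> 'a set" where
  "dist_support U =
     {x. \<forall>V. open V \<and> x \<in> V \<longrightarrow>
        (\<exists>f. test_function f \<and> closure {y. f y \<noteq> 0} \<subseteq> V \<and> U f \<noteq> 0)}"

definition cutoff_for :: "'a::euclidean_space set \<Rightarrow> ('a \<Rightarrow> complex) \<Rightarrow> bool" where
  "cutoff_for K \<eta> \<longleftrightarrow>
     test_function \<eta> \<and> (\<exists>V. open V \<and> K \<subseteq> V \<and> (\<forall>x\<in>V. \<eta> x = 1))"

text \<open>The pairing of a compactly supported distribution with an arbitrary smooth function
  multiplies the function by a cutoff that equals 1 near the support. For \<open>U\<close> a tempered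
  distribution with compact support and \<open>f\<close> smooth, such cutoffs exist and the value does not
  depend on which one is chosen.\<close>

definition pairing ::
    "(('a::euclidean_space \<Rightarrow> complex) \<Rightarrow> complex) \<Rightarrow> ('a \<Rightarrow> complex) \<Rightarrow> complex" where
  "pairing U f = (let \<eta> = (SOME \<eta>. cutoff_for (dist_support U) \<eta>) in U (\<lambda>x. \<eta> x * f x))"


section \<open>Spherical functions on the Heisenberg group\<close>

text \<open>The dimension \<open>n \<ge> 1\<close> is \<open>CARD('n)\<close>, and \<open>norm\<close> on \<open>complex ^ 'n\<close> is the Hermitian norm;
  the variable \<open>l\<close> is the central parameter usually written as lambda.\<close>

definition spherical ::
    "complex \<Rightarrow> complex \<Rightarrow> complex ^ 'n \<Rightarrow> real \<Rightarrow> complex" where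
  "spherical \<xi> l z t =
     exp (\<i> * l * of_real t) * exp (- l * of_real ((norm z)\<^sup>2) / 4) *
     (1 + (\<Sum>\<^sub>\<infinity>k\<in>{1..}.
        of_real (norm z ^ (2 * k)) / (pochhammer (of_nat CARD('n)) k * fact k * 4 ^ k) *
        (\<Prod>d = 0..k - 1. (l * of_nat (2 * d + CARD('n)) - \<xi>))))"

definition f_U ::
    "((real \<times> real \<Rightarrow> complex) \<Rightarrow> complex) \<Rightarrow> complex ^ 'n \<Rightarrow> real \<Rightarrow> complex" where
  "f_U U z t = pairing U (\<lambda>(\<xi>, l). spherical (of_real \<xi>) (of_real l) z t)"


section \<open>Holomorphic functions of several variables\<close>

text \<open>Complex Frechet differentiability everywhere, with \<open>\<complex>\<^sup>2\<^sup>n\<^sup>+\<^sup>1\<close> realised as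
  \<open>\<complex>\<^sup>n \<times> \<complex>\<^sup>n \<times> \<complex>\<close>.\<close>

definition entire ::
    "((complex ^ 'n) \<times> (complex ^ 'n) \<times> complex \<Rightarrow> complex) \<Rightarrow> bool" where
  "entire F \<longleftrightarrow>
     (\<forall>p. \<exists>D. (F has_derivative D) (at p) \<and>
        (\<forall>c u v w. D (c *s u, c *s v, c * w) = c * D (u, v, w)))"

end

theory Submission
  imports Defs
begin

text \<open>Write \<open>s\<close> for the square sum of \<open>x\<close> and \<open>y\<close> and put \<open>\<zeta> = \<i> t - s / 4\<close>. Expanding the
  exponential turns the spherical function into a double power series in \<open>(\<zeta>, s)\<close> whose
  coefficients are polynomials in \<open>(\<xi>, \<lambda>)\<close>. On a ball containing the support of the cutoff, all
  derivatives of order at most \<open>N\<close> of the coefficient of index \<open>(j, k)\<close> are at most a constant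
  times \<open>A ^ j / j! * A ^ k / k!\<close>. Hence the series, multiplied by the cutoff, converges in the
  Schwartz space, the distribution can be applied to it term by term, and the resulting power
  series in \<open>(\<zeta>, s)\<close> is entire. Both \<open>\<zeta>\<close> and \<open>s\<close> are polynomials in \<open>(x, y, t)\<close>.\<close>

section \<open>Calculus of smooth functions\<close>

text \<open>The variables \<zeta> and s are chosen because exp (i \<lambda> t) exp (- \<lambda> s /
  4) = exp (\<lambda> \<zeta>), whose coefficient of \<zeta>^j is just \<lambda>^j / j!. In the
  other factor, a product of k linear forms is at most (n)_k (2 R)^k on the ball of radius R. The
  Pochhammer symbol cancels (n)_k and one k! survives in the denominator, so the series in s
  converges on the whole plane and not merely in a disc. Passing to coefficients before applying U
  turns holomorphy into a statement about a numerical power series; no derivative of U along a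
  complex parameter is ever taken. The obstacle is that the derivative bounds must be uniform in (j,
  k), although the Leibniz rule is applied to products of arbitrarily many factors. Only the
  derivatives up to the order N of a continuity estimate for U matter for the coefficients, and for
  fixed N each factor costs at most 2^N. This exponential loss goes into the constant A, which
  becomes 2^N * 2 R, and the factorials absorb it.\<close>

abbreviation pderiv_at :: "'a::euclidean_space \<Rightarrow> ('a \<Rightarrow> complex) \<Rightarrow> 'a \<Rightarrow> complex" where
  "pderiv_at b f \<equiv> \<lambda>x. frechet_derivative f (at x) b"

text \<open>In \<open>iter_deriv\<close> the head of the list is the outermost derivative. Closure
  under products and inverses needs the opposite order: differentiate once, recognise expressions of
  the same kind, and continue with one order less. This recursion peels off the innermost
  derivative.\<close>

primrec times_diff :: "nat \<Rightarrow> ('a::euclidean_space \<Rightarrow> complex) \<Rightarrow> bool" where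
  "times_diff 0 f = True"
| "times_diff (Suc n) f \<longleftrightarrow>
     (\<forall>x. f differentiable (at x)) \<and> (\<forall>b\<in>Basis. times_diff n (pderiv_at b f))"

lemma iter_deriv_snoc: "iter_deriv (bs @ [b]) f = iter_deriv bs (pderiv_at b f)"
  by (induction bs) simp_all

text \<open>Order \<open>n\<close> means that the iterated derivatives of order below
  \<open>n\<close> are differentiable, hence the strict inequality. Splitting lists at their end
  matches the recursion.\<close>

lemma times_diff_iff:
  "times_diff n f \<longleftrightarrow>
     (\<forall>bs x. length bs < n \<longrightarrow> set bs \<subseteq> Basis \<longrightarrow> iter_deriv bs f differentiable (at x))"
proof (induction n arbitrary: f)
  case 0
  then show ?case by simp
next
  case (Suc n)
  show ?case
  proof
    assume L: "times_diff (Suc n) f"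
    show "\<forall>bs x. length bs < Suc n \<longrightarrow> set bs \<subseteq> Basis \<longrightarrow> iter_deriv bs f differentiable (at x)"
    proof (intro allI impI)
      fix bs :: "'a list" and x
      assume l: "length bs < Suc n" and s: "set bs \<subseteq> Basis"
      show "iter_deriv bs f differentiable (at x)"
      proof (cases bs rule: rev_cases)
        case Nil
        then show ?thesis using L by simp
      next
        case (snoc cs b)
        have "times_diff n (pderiv_at b f)" using L s snoc by simp
        then show ?thesis using Suc.IH[of "pderiv_at b f"] l s snoc by (simp add: iter_deriv_snoc)
      qed
    qed
  next
    assume R: "\<forall>bs x. length bs < Suc n \<longrightarrow> set bs \<subseteq> Basis \<longrightarrow> iter_deriv bs f differentiable (at x)"
    have "f differentiable (at x)" for x
      using R[rule_format, of "[]" x] by simp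
    moreover have "times_diff n (pderiv_at b f)" if "b \<in> Basis" for b
      unfolding Suc.IH
    proof (intro allI impI)
      fix bs :: "'a list" and x
      assume "length bs < n" "set bs \<subseteq> Basis"
      then show "iter_deriv bs (pderiv_at b f) differentiable (at x)"
        using R[rule_format, of "bs @ [b]" x] that by (simp add: iter_deriv_snoc)
    qed
    ultimately show "times_diff (Suc n) f" by simp
  qed
qed

lemma smooth_iff_times_diff: "smooth f \<longleftrightarrow> (\<forall>n. times_diff n f)"
  unfolding smooth_def times_diff_iff by (meson lessI)

lemma smooth_times_diff: "smooth f \<Longrightarrow> times_diff n f"
  by (simp add: smooth_iff_times_diff)

lemma smooth_differentiable: "smooth f \<Longrightarrow> f differentiable (at x)"
  using smooth_times_diff[of f "Suc 0"] by simp

lemma smooth_pderiv: "smooth f \<Longrightarrow> b \<in> Basis \<Longrightarrow> smooth (pderiv_at b f)"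
  unfolding smooth_iff_times_diff by (metis times_diff.simps(2))

lemma times_diff_SucD: "times_diff (Suc n) f \<Longrightarrow> times_diff n f"
  by (simp add: times_diff_iff)

lemma pderiv_eqI: "(f has_derivative f') (at x) \<Longrightarrow> pderiv_at b f x = f' b"
  using frechet_derivative_at by metis

section \<open>Closure of differentiable and smooth functions under algebraic operations\<close>

lemma pderiv_add:
  assumes "\<And>x. f differentiable (at x)" "\<And>x. g differentiable (at x)"
  shows "pderiv_at b (\<lambda>x. f x + g x) = (\<lambda>x. pderiv_at b f x + pderiv_at b g x)"
proof
  fix x
  have "((\<lambda>x. f x + g x) has_derivative
      (\<lambda>h. frechet_derivative f (at x) h + frechet_derivative g (at x) h)) (at x)"
    by (intro derivative_intros assms[unfolded frechet_derivative_works])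
  then show "pderiv_at b (\<lambda>x. f x + g x) x = pderiv_at b f x + pderiv_at b g x"
    by (rule pderiv_eqI)
qed

lemma pderiv_mult:
  assumes "\<And>x. f differentiable (at x)" "\<And>x. g differentiable (at x)"
  shows "pderiv_at b (\<lambda>x. f x * g x) = (\<lambda>x. f x * pderiv_at b g x + pderiv_at b f x * g x)"
proof
  fix x
  have "((\<lambda>x. f x * g x) has_derivative
      (\<lambda>h. f x * frechet_derivative g (at x) h + frechet_derivative f (at x) h * g x)) (at x)"
    by (intro has_derivative_mult assms[unfolded frechet_derivative_works])
  then show "pderiv_at b (\<lambda>x. f x * g x) x = f x * pderiv_at b g x + pderiv_at b f x * g x"
    by (rule pderiv_eqI)
qed

lemma pderiv_const: "pderiv_at b (\<lambda>x. c) = (\<lambda>x. 0)"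
  using pderiv_eqI[OF has_derivative_const] by blast

lemma times_diff_const: "times_diff n (\<lambda>x. c)"
proof (induction n arbitrary: c)
  case (Suc n)
  show ?case by (simp add: pderiv_const Suc.IH)
qed simp

lemma times_diff_add: "times_diff n f \<Longrightarrow> times_diff n g \<Longrightarrow> times_diff n (\<lambda>x. f x + g x)"
proof (induction n arbitrary: f g)
  case (Suc n)
  then have d: "\<And>x. f differentiable (at x)" "\<And>x. g differentiable (at x)"
    by simp_all
  show ?case using Suc d by (auto simp: pderiv_add[OF d])
qed simp

lemma times_diff_mult: "times_diff n f \<Longrightarrow> times_diff n g \<Longrightarrow> times_diff n (\<lambda>x. f x * g x)"
proof (induction n arbitrary: f g)
  case (Suc n)
  then have d: "\<And>x. f differentiable (at x)" "\<And>x. g differentiable (at x)"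
    by simp_all
  have "times_diff n f" "times_diff n g" using Suc.prems times_diff_SucD by blast+
  with Suc show ?case by (auto simp: pderiv_mult[OF d] intro!: times_diff_add)
qed simp

lemma smooth_const [simp]: "smooth (\<lambda>x. c)"
  by (simp add: smooth_iff_times_diff times_diff_const)

lemma smooth_add: "smooth f \<Longrightarrow> smooth g \<Longrightarrow> smooth (\<lambda>x. f x + g x)"
  by (simp add: smooth_iff_times_diff times_diff_add)

lemma smooth_mult: "smooth f \<Longrightarrow> smooth g \<Longrightarrow> smooth (\<lambda>x. f x * g x)"
  by (simp add: smooth_iff_times_diff times_diff_mult)

lemma smooth_cmult: "smooth f \<Longrightarrow> smooth (\<lambda>x. c * f x)"
  by (rule smooth_mult[OF smooth_const])

lemma smooth_diff:
  assumes "smooth f" "smooth g"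
  shows "smooth (\<lambda>x. f x - g x)"
  using smooth_add[OF assms(1) smooth_cmult[OF assms(2), of "-1"]] by simp

lemma smooth_sum: "(\<And>i. i \<in> I \<Longrightarrow> smooth (f i)) \<Longrightarrow> smooth (\<lambda>x. \<Sum>i\<in>I. f i x)"
  by (induction I rule: infinite_finite_induct) (auto intro: smooth_add)

lemma smooth_prod: "(\<And>i. i \<in> I \<Longrightarrow> smooth (f i)) \<Longrightarrow> smooth (\<lambda>x. \<Prod>i\<in>I. f i x)"
  by (induction I rule: infinite_finite_induct) (auto intro: smooth_mult)

lemma smooth_power: "smooth f \<Longrightarrow> smooth (\<lambda>x. f x ^ k)"
  by (induction k) (auto intro: smooth_mult)

lemma pderiv_bounded_linear:
  "bounded_linear f \<Longrightarrow> pderiv_at b f = (\<lambda>x. f b)"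
  using pderiv_eqI[OF bounded_linear_imp_has_derivative] by blast

lemma smooth_bounded_linear:
  assumes "bounded_linear f"
  shows "smooth f"
  unfolding smooth_iff_times_diff
proof
  fix n show "times_diff n f"
    by (cases n) (auto simp: pderiv_bounded_linear[OF assms] times_diff_const
        intro: bounded_linear_imp_differentiable assms)
qed

text \<open>The derivative of 1/f is, up to sign, a product of f' and two copies of 1/f, and there
  1/f is needed at one order less only.\<close>

lemma times_diff_inverse:
  assumes "times_diff n f" "\<And>x. f x \<noteq> 0"
  shows "times_diff n (\<lambda>x. inverse (f x))"
  using assms(1)
proof (induction n)
  case (Suc n)
  then have d: "\<And>x. f differentiable (at x)" by simp
  have D: "((\<lambda>x. inverse (f x)) has_derivative
      (\<lambda>h. - (inverse (f x) * frechet_derivative f (at x) h * inverse (f x)))) (at x)" for x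
    by (intro Deriv.has_derivative_inverse assms d[unfolded frechet_derivative_works])
  have E: "pderiv_at b (\<lambda>x. inverse (f x)) =
      (\<lambda>x. (- 1) * (inverse (f x) * pderiv_at b f x * inverse (f x)))" for b
    using pderiv_eqI[OF D] by (auto simp: fun_eq_iff)
  have "times_diff n f" using Suc.prems times_diff_SucD by blast
  then have I: "times_diff n (\<lambda>x. inverse (f x))" by (rule Suc.IH)
  have "times_diff n (pderiv_at b f)" if "b \<in> Basis" for b
    using Suc.prems that by simp
  then have "times_diff n (pderiv_at b (\<lambda>x. inverse (f x)))" if "b \<in> Basis" for b
    unfolding E using that by (intro times_diff_mult times_diff_const I)
  moreover have "(\<lambda>x. inverse (f x)) differentiable (at x)" for x
    using D differentiable_def by blast
  ultimately show ?case by simp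
qed simp

lemma smooth_inverse: "smooth f \<Longrightarrow> (\<And>x. f x \<noteq> 0) \<Longrightarrow> smooth (\<lambda>x. inverse (f x))"
  by (simp add: smooth_iff_times_diff times_diff_inverse)

section \<open>Iterated partial derivatives of sums and products\<close>

lemma iter_deriv_add:
  assumes "smooth f" "smooth g" "set bs \<subseteq> Basis"
  shows "iter_deriv bs (\<lambda>x. f x + g x) = (\<lambda>x. iter_deriv bs f x + iter_deriv bs g x)"
  using assms(3)
proof (induction bs)
  case (Cons b bs)
  then have "\<And>x. iter_deriv bs f differentiable (at x)" "\<And>x. iter_deriv bs g differentiable (at x)"
    using assms unfolding smooth_def by auto
  from pderiv_add[OF this, of b] show ?case using Cons by simp
qed simp

lemma iter_deriv_cmult:
  assumes "smooth f" "set bs \<subseteq> Basis"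
  shows "iter_deriv bs (\<lambda>x. c * f x) = (\<lambda>x. c * iter_deriv bs f x)"
  using assms(2)
proof (induction bs)
  case (Cons b bs)
  then have "\<And>x. iter_deriv bs f differentiable (at x)"
    using assms unfolding smooth_def by auto
  from pderiv_mult[OF _ this, of "\<lambda>x. c" b] show ?case using Cons by (simp add: pderiv_const)
qed simp

lemma iter_deriv_const: "iter_deriv bs (\<lambda>x. c) = (\<lambda>x. if bs = [] then c else 0)"
  by (induction bs) (auto simp: pderiv_const)

lemma iter_deriv_sum:
  assumes "\<And>i. smooth (f i)" "set bs \<subseteq> Basis"
  shows "iter_deriv bs (\<lambda>x. \<Sum>i\<in>I. f i x) = (\<lambda>x. \<Sum>i\<in>I. iter_deriv bs (f i) x)"
proof (induction I rule: infinite_finite_induct)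
  case (insert i I)
  then show ?case
    using iter_deriv_add[OF assms(1)[of i] smooth_sum[of I f] assms(2)] assms(1) by simp
qed (auto simp: iter_deriv_const)

text \<open>Each differentiation of a product at most doubles the number of summands.\<close>

lemma norm_iter_deriv_mult_le:
  assumes "smooth f" "smooth g" "set bs \<subseteq> Basis"
    and "\<And>cs. length cs \<le> length bs \<Longrightarrow> set cs \<subseteq> Basis \<Longrightarrow> norm (iter_deriv cs f x) \<le> M"
    and "\<And>cs. length cs \<le> length bs \<Longrightarrow> set cs \<subseteq> Basis \<Longrightarrow> norm (iter_deriv cs g x) \<le> M'"
  shows "norm (iter_deriv bs (\<lambda>x. f x * g x) x) \<le> 2 ^ length bs * (M * M')"
  using assms
proof (induction bs arbitrary: f g rule: rev_induct)
  case Nil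
  have "norm (f x) \<le> M" "norm (g x) \<le> M'"
    using Nil(4)[of "[]"] Nil(5)[of "[]"] by simp_all
  then show ?case by (simp add: norm_mult mult_mono')
next
  case (snoc b bs)
  have b: "b \<in> Basis" and bs: "set bs \<subseteq> Basis" using snoc.prems by auto
  note sf = smooth_pderiv[OF snoc.prems(1) b] and sg = smooth_pderiv[OF snoc.prems(2) b]
  have f: "norm (iter_deriv cs f x) \<le> M" "norm (iter_deriv cs (pderiv_at b f) x) \<le> M"
    if "length cs \<le> length bs" "set cs \<subseteq> Basis" for cs
    using snoc.prems(4)[of cs] snoc.prems(4)[of "cs @ [b]"] that b by (simp_all add: iter_deriv_snoc)
  have g: "norm (iter_deriv cs g x) \<le> M'" "norm (iter_deriv cs (pderiv_at b g) x) \<le> M'"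
    if "length cs \<le> length bs" "set cs \<subseteq> Basis" for cs
    using snoc.prems(5)[of cs] snoc.prems(5)[of "cs @ [b]"] that b by (simp_all add: iter_deriv_snoc)
  have "iter_deriv (bs @ [b]) (\<lambda>x. f x * g x) =
      (\<lambda>x. iter_deriv bs (\<lambda>x. f x * pderiv_at b g x) x + iter_deriv bs (\<lambda>x. pderiv_at b f x * g x) x)"
    unfolding iter_deriv_snoc pderiv_mult[OF snoc.prems(1,2)[THEN smooth_differentiable]]
    by (intro iter_deriv_add smooth_mult snoc.prems sf sg bs)
  moreover have "norm (iter_deriv bs (\<lambda>x. f x * pderiv_at b g x) x) \<le> 2 ^ length bs * (M * M')"
    by (rule snoc.IH[OF snoc.prems(1) sg bs f(1) g(2)])
  moreover have "norm (iter_deriv bs (\<lambda>x. pderiv_at b f x * g x) x) \<le> 2 ^ length bs * (M * M')"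
    by (rule snoc.IH[OF sf snoc.prems(2) bs f(2) g(1)])
  ultimately show ?case
    by simp (metis (no_types, lifting) add_mono mult.assoc mult_2 norm_triangle_le)
qed

section \<open>Smooth cutoff functions\<close>

text \<open>The derivatives of the flat function exp (- 1 / t) contain negative powers of t. With
  all exponents \<open>m\<close> included, the derivative of a member is a linear combination of
  members.\<close>

definition exp_flat :: "nat \<Rightarrow> real \<Rightarrow> real" where
  "exp_flat m t = (if 0 < t then exp (- (1 / t)) / t ^ m else 0)"

lemma exp_flat_nonneg: "0 \<le> exp_flat m t"
  by (simp add: exp_flat_def)

lemma power_le_fact_mult_exp:
  fixes x :: real
  assumes "0 \<le> x"
  shows "x ^ k \<le> fact k * exp x"
proof -
  have "(\<Sum>i\<in>{k}. inverse (fact i) * x ^ i) \<le> (\<Sum>i. inverse (fact i) * x ^ i)"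
    by (rule sum_le_suminf[OF summable_exp]) (use assms in auto)
  then have "inverse (fact k) * x ^ k \<le> exp x"
    by (simp add: exp_def)
  then show ?thesis by (simp add: field_simps)
qed

text \<open>Put x = 1 / t in x^(m + 2) \<le> (m + 2)! exp x. The two powers beyond m give the
  quadratic decay that makes every member differentiable at 0.\<close>

lemma exp_flat_le_square: "exp_flat m t \<le> fact (m + 2) * t\<^sup>2"
proof (cases "0 < t")
  case True
  have "(1 / t) ^ (m + 2) \<le> fact (m + 2) * exp (1 / t)"
    using True by (intro power_le_fact_mult_exp) simp
  then have "exp (- (1 / t)) * (1 / t) ^ (m + 2) \<le> exp (- (1 / t)) * (fact (m + 2) * exp (1 / t))"
    by (rule mult_left_mono) simp
  also have "\<dots> = fact (m + 2)"
    by (simp add: exp_minus del: fact_Suc)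
  finally have "exp (- (1 / t)) * (1 / t) ^ (m + 2) \<le> fact (m + 2)" .
  then have "exp (- (1 / t)) * (1 / t) ^ (m + 2) * t\<^sup>2 \<le> fact (m + 2) * t\<^sup>2"
    by (rule mult_right_mono) simp
  moreover have "exp (- (1 / t)) * (1 / t) ^ (m + 2) * t\<^sup>2 = exp_flat m t"
    using True by (simp add: exp_flat_def power_add power2_eq_square field_simps)
  ultimately show ?thesis by simp
qed (simp add: exp_flat_def)

lemma DERIV_exp_flat:
  "(exp_flat m has_real_derivative (exp_flat (m + 2) t - m * exp_flat (m + 1) t)) (at t)"
proof -
  consider "t > 0" | "t < 0" | "t = 0" by linarith
  then show ?thesis
  proof cases
    case 1
    have inv: "((\<lambda>t. 1 / t) has_real_derivative - ((1 / t)\<^sup>2)) (at t)"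
      using DERIV_inverse[of t UNIV] 1 by (simp add: inverse_eq_divide numeral_2_eq_2)
    have "((\<lambda>t. exp (- (1 / t)) * (1 / t) ^ m) has_real_derivative
        exp (- (1 / t)) * (1 / t)\<^sup>2 * (1 / t) ^ m
        - m * (exp (- (1 / t)) * ((1 / t)\<^sup>2 * (1 / t) ^ (m - 1)))) (at t)"
      by (rule derivative_eq_intros inv refl)+ (simp add: algebra_simps)
    also have "exp (- (1 / t)) * (1 / t)\<^sup>2 * (1 / t) ^ m = exp_flat (m + 2) t"
      using 1 by (simp add: exp_flat_def power_add power_divide power2_eq_square)
    also have "m * (exp (- (1 / t)) * ((1 / t)\<^sup>2 * (1 / t) ^ (m - 1))) = m * exp_flat (m + 1) t"
      using 1 by (cases m) (simp_all add: exp_flat_def power_divide power2_eq_square)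
    finally have "((\<lambda>t. exp (- (1 / t)) * (1 / t) ^ m) has_real_derivative
        (exp_flat (m + 2) t - m * exp_flat (m + 1) t)) (at t)" .
    moreover have "eventually (\<lambda>s. exp_flat m s = exp (- (1 / s)) * (1 / s) ^ m) (nhds t)"
      using eventually_nhds_in_open[of "{0<..}" t] 1
      by (auto elim!: eventually_mono simp: exp_flat_def power_divide)
    ultimately show ?thesis by (subst DERIV_cong_ev[OF refl _ refl])
  next
    case 2
    have "eventually (\<lambda>s. exp_flat m s = 0) (nhds t)"
      using eventually_nhds_in_open[of "{..<0}" t] 2
      by (auto elim!: eventually_mono simp: exp_flat_def)
    then have "(exp_flat m has_real_derivative 0) (at t)"
      by (subst DERIV_cong_ev[OF refl _ refl]) auto
    then show ?thesis using 2 by (simp add: exp_flat_def)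
  next
    case 3
    have "((\<lambda>h. exp_flat m h / h) \<longlongrightarrow> 0) (at 0)"
    proof (rule Lim_null_comparison)
      show "\<forall>\<^sub>F h in at 0. norm (exp_flat m h / h) \<le> fact (m + 2) * \<bar>h\<bar>"
      proof (rule eventuallyI)
        \<comment> \<open>No point has to be excluded: at \<open>h = 0\<close> both sides are 0,
          since division by zero gives 0.\<close>
        fix h :: real
        have "norm (exp_flat m h / h) \<le> fact (m + 2) * h\<^sup>2 / \<bar>h\<bar>"
          using exp_flat_le_square[of m h] exp_flat_nonneg[of m h]
          by (simp add: divide_right_mono del: fact_Suc)
        also have "\<dots> = fact (m + 2) * \<bar>h\<bar>"
          by (simp add: power2_eq_square abs_if del: fact_Suc)
        finally show "norm (exp_flat m h / h) \<le> fact (m + 2) * \<bar>h\<bar>" .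
      qed
      show "((\<lambda>h::real. fact (m + 2) * \<bar>h\<bar>) \<longlongrightarrow> 0) (at 0)"
        by (auto intro!: tendsto_eq_intros simp del: fact_Suc)
    qed
    then show ?thesis using 3
      by (simp add: has_field_derivative_iff exp_flat_def)
  qed
qed

text \<open>The induction runs over all \<open>m\<close> at once, since each differentiation raises
  the exponent. The other factor from the chain rule is a partial derivative of \<rho>, smooth by
  assumption.\<close>

lemma times_diff_exp_flat:
  fixes \<rho> :: "'a::euclidean_space \<Rightarrow> real"
  assumes "smooth (\<lambda>x. of_real (\<rho> x))"
  shows "times_diff n (\<lambda>x. of_real (exp_flat m (\<rho> x)))"
proof (induction n arbitrary: m)
  case (Suc n)
  let ?r = "\<lambda>x. complex_of_real (\<rho> x)"
  have r: "(?r has_derivative frechet_derivative ?r (at x)) (at x)" for x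
    using smooth_differentiable[OF assms] frechet_derivative_works by blast
  \<comment> \<open>\<open>smooth\<close> is a notion for complex-valued functions, so the real
    derivative of \<rho> is recovered as a real part.\<close>
  have re: "(\<rho> has_derivative (\<lambda>h. Re (pderiv_at h ?r x))) (at x)" for x
    using has_derivative_Re[OF r] by simp
  have ofre: "of_real (Re (pderiv_at h ?r x)) = pderiv_at h ?r x" for h x
    by (rule pderiv_eqI[OF has_derivative_of_real[OF re], symmetric])
  have D: "((\<lambda>x. complex_of_real (exp_flat m (\<rho> x))) has_derivative
      (\<lambda>h. (of_real (exp_flat (m + 2) (\<rho> x)) + (- of_nat m) * of_real (exp_flat (m + 1) (\<rho> x)))
         * pderiv_at h ?r x)) (at x)" (is "(_ has_derivative ?D x) _") for x
  proof -
    have "((\<lambda>x. exp_flat m (\<rho> x)) has_derivative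
        (\<lambda>h. (exp_flat (m + 2) (\<rho> x) - m * exp_flat (m + 1) (\<rho> x)) * Re (pderiv_at h ?r x))) (at x)"
      using has_derivative_compose[OF re
          DERIV_exp_flat[of m "\<rho> x", unfolded has_field_derivative_def]]
      by simp
    from has_derivative_of_real[OF this, where 'a = complex] show ?thesis
      by (simp add: ofre)
  qed
  have E: "pderiv_at b (\<lambda>x. complex_of_real (exp_flat m (\<rho> x))) = (\<lambda>x. ?D x b)" for b
    using pderiv_eqI[OF D] by (auto simp: fun_eq_iff)
  have "times_diff n (pderiv_at b ?r)" if "b \<in> Basis" for b
    using smooth_pderiv[OF assms that] by (rule smooth_times_diff)
  then have "times_diff n (pderiv_at b (\<lambda>x. complex_of_real (exp_flat m (\<rho> x))))" if "b \<in> Basis" for b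
    unfolding E using that by (intro times_diff_mult times_diff_add times_diff_const Suc.IH)
  moreover have "(\<lambda>x. complex_of_real (exp_flat m (\<rho> x))) differentiable (at x)" for x
    using D differentiable_def by blast
  ultimately show ?case by simp
qed simp

lemma smooth_inner_self: "smooth (\<lambda>x::'a::euclidean_space. of_real (x \<bullet> x))"
proof -
  have "smooth (\<lambda>x::'a. \<Sum>b\<in>Basis. of_real (x \<bullet> b) ^ 2)"
    by (intro smooth_sum smooth_power smooth_bounded_linear bounded_linear_of_real
        bounded_linear_compose[OF bounded_linear_of_real bounded_linear_inner_left])
  then show ?thesis
    by (subst euclidean_inner) (simp add: power2_eq_square)
qed

text \<open>Near \<open>K\<close> the second summand of the denominator vanishes, far from \<open>K\<close> the first one does.\<close>

lemma cutoff_for_exists: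
  fixes K :: "'a::euclidean_space set"
  assumes "compact K"
  shows "\<exists>\<eta>. cutoff_for K \<eta>"
proof -
  obtain r where r: "0 < r" "\<And>x. x \<in> K \<Longrightarrow> norm x < r"
    using bounded_pos_less[of K] compact_imp_bounded[OF assms] by auto
  define A B where "A x = exp_flat 0 ((r + 1)\<^sup>2 - x \<bullet> x)" and "B x = exp_flat 0 (x \<bullet> x - r\<^sup>2)" for x :: 'a
  define \<eta> where "\<eta> x = of_real (A x) * inverse (complex_of_real (A x) + of_real (B x))" for x
  have lt: "r\<^sup>2 < (r + 1)\<^sup>2" using r by (simp add: power2_eq_square algebra_simps)
  \<comment> \<open>As r < r + 1, every point lies inside the larger ball or outside the smaller
    one, so one of the two summands is positive.\<close>
  have pos: "0 < A x + B x" for x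
  proof (cases "x \<bullet> x < (r + 1)\<^sup>2")
    case True
    then have "0 < A x" by (simp add: A_def exp_flat_def)
    then show ?thesis using exp_flat_nonneg by (simp add: B_def add_pos_nonneg)
  next
    case False
    then have "0 < B x" using lt by (simp add: B_def exp_flat_def)
    then show ?thesis using exp_flat_nonneg by (simp add: A_def add_nonneg_pos)
  qed
  have nz: "complex_of_real (A x) + of_real (B x) \<noteq> 0" for x
    using pos[of x] by (metis of_real_add of_real_eq_0_iff less_irrefl)
  have sA: "smooth (\<lambda>x. complex_of_real (A x))" unfolding A_def smooth_iff_times_diff
  proof (rule allI, rule times_diff_exp_flat)
    show "smooth (\<lambda>x::'a. complex_of_real ((r + 1)\<^sup>2 - x \<bullet> x))"
      unfolding of_real_diff by (intro smooth_diff smooth_const smooth_inner_self)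
  qed
  have sB: "smooth (\<lambda>x. complex_of_real (B x))" unfolding B_def smooth_iff_times_diff
  proof (rule allI, rule times_diff_exp_flat)
    show "smooth (\<lambda>x::'a. complex_of_real (x \<bullet> x - r\<^sup>2))"
      unfolding of_real_diff by (intro smooth_diff smooth_const smooth_inner_self)
  qed
  have "smooth \<eta>" unfolding \<eta>_def
    by (intro smooth_mult smooth_inverse smooth_add sA sB nz)
  moreover have "{x. \<eta> x \<noteq> 0} \<subseteq> cball 0 (r + 1)"
  proof
    fix x assume "x \<in> {x. \<eta> x \<noteq> 0}"
    then have "A x \<noteq> 0" by (auto simp: \<eta>_def)
    then have "(norm x)\<^sup>2 \<le> (r + 1)\<^sup>2"
      by (auto simp: A_def exp_flat_def power2_norm_eq_inner split: if_splits)
    then show "x \<in> cball 0 (r + 1)" using r by (simp add: abs_le_square_iff[symmetric])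
  qed
  then have "compact (closure {x. \<eta> x \<noteq> 0})"
    using bounded_subset[OF bounded_cball] compact_closure by blast
  moreover have "\<eta> x = 1" if "x \<in> ball 0 r" for x
  proof -
    have "(norm x)\<^sup>2 < r\<^sup>2" using that r by (simp add: power_strict_mono)
    then have "B x = 0" by (simp add: B_def exp_flat_def power2_norm_eq_inner)
    then show ?thesis using nz[of x] by (simp add: \<eta>_def)
  qed
  moreover have "K \<subseteq> ball 0 r" using r by auto
  ultimately show ?thesis
    unfolding cutoff_for_def test_function_def using open_ball by blast
qed

section \<open>Series of smooth functions\<close>

lemma norm_suminf_diff_partial_le:
  fixes a :: "nat \<Rightarrow> 'a::banach"
  assumes "summable M" "\<And>i. norm (a i) \<le> M i"
  shows "norm (suminf a - (\<Sum>i<n. a i)) \<le> suminf M - (\<Sum>i<n. M i)"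
proof -
  have sa: "summable a"
    by (rule summable_comparison_test'[OF assms(1)]) (rule assms(2))
  have sM: "summable (\<lambda>i. M (i + n))"
    using assms(1) by (rule summable_ignore_initial_segment)
  have "norm (\<Sum>i. a (i + n)) \<le> (\<Sum>i. M (i + n))"
    by (rule norm_suminf_le[OF _ sM]) (rule assms(2))
  then show ?thesis
    by (simp add: suminf_minus_initial_segment[OF sa] suminf_minus_initial_segment[OF assms(1)])
qed

lemma suminf_diff_partial_tendsto_0:
  fixes M :: "nat \<Rightarrow> real"
  assumes "summable M"
  shows "(\<lambda>n. suminf M - (\<Sum>i<n. M i)) \<longlonglongrightarrow> 0"
  using tendsto_diff[OF tendsto_const summable_LIMSEQ[OF assms], of "suminf M"] by simp

text \<open>The M-test for derivatives: a summable bound on the operator norms gives the uniform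
  convergence that \<open>has_derivative_series\<close> asks for. Leaving \<open>S\<close> open
  permits the whole space for smooth functions and balls for power series, whose majorants depend on
  the radius.\<close>

lemma has_derivative_suminf:
  fixes f :: "nat \<Rightarrow> 'a::real_normed_vector \<Rightarrow> 'b::banach"
  assumes "convex S" "open S"
    and "\<And>n x. x \<in> S \<Longrightarrow> (f n has_derivative f' n x) (at x)"
    and "\<And>n x h. x \<in> S \<Longrightarrow> norm (f' n x h) \<le> M n * norm h"
    and "summable M"
    and "\<And>x. x \<in> S \<Longrightarrow> summable (\<lambda>n. f n x)"
    and "x \<in> S"
  shows "((\<lambda>x. \<Sum>n. f n x) has_derivative (\<lambda>h. \<Sum>n. f' n x h)) (at x)"
proof -
  let ?g' = "\<lambda>x h. \<Sum>n. f' n x h"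
  have "\<exists>g. \<forall>x\<in>S. (\<lambda>n. f n x) sums g x \<and> (g has_derivative ?g' x) (at x within S)"
  proof (rule has_derivative_series[where f' = f' and x = x and l = "\<Sum>n. f n x", OF assms(1)])
    show "(f n has_derivative f' n x) (at x within S)" if "x \<in> S" for n x
      using assms(3)[OF that] by (rule has_derivative_at_withinI)
    fix e :: real assume e: "e > 0"
    have "\<forall>\<^sub>F n in sequentially. suminf M - (\<Sum>i<n. M i) < e"
      using suminf_diff_partial_tendsto_0[OF assms(5)] e by (rule order_tendstoD(2))
    then show "\<forall>\<^sub>F n in sequentially. \<forall>x\<in>S. \<forall>h. norm ((\<Sum>i<n. f' i x h) - ?g' x h) \<le> e * norm h"
    proof (rule eventually_mono, intro ballI allI)
      fix n x h assume n: "suminf M - (\<Sum>i<n. M i) < e" and x: "x \<in> S"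
      have "norm (?g' x h - (\<Sum>i<n. f' i x h)) \<le> (\<Sum>i. M i * norm h) - (\<Sum>i<n. M i * norm h)"
        by (rule norm_suminf_diff_partial_le[OF summable_mult2[OF assms(5)] assms(4)[OF x]])
      also have "\<dots> = (suminf M - (\<Sum>i<n. M i)) * norm h"
        by (simp only: suminf_mult2[OF assms(5)] sum_distrib_right left_diff_distrib)
      also have "\<dots> \<le> e * norm h" using n by (intro mult_right_mono) auto
      finally show "norm ((\<Sum>i<n. f' i x h) - ?g' x h) \<le> e * norm h"
        by (simp add: norm_minus_commute)
    qed
  next
    show "x \<in> S" by (rule assms(7))
    show "(\<lambda>n. f n x) sums (\<Sum>n. f n x)" using assms(6)[OF assms(7)] by (rule summable_sums)
  qed
  then obtain g where "\<forall>x\<in>S. (\<lambda>n. f n x) sums g x \<and> (g has_derivative ?g' x) (at x within S)" ..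
  then have g: "\<And>x. x \<in> S \<Longrightarrow> (\<lambda>n. f n x) sums g x"
    "\<And>x. x \<in> S \<Longrightarrow> (g has_derivative ?g' x) (at x within S)" by blast+
  have "(g has_derivative ?g' x) (at x)"
    using g(2)[OF assms(7)] unfolding at_within_open[OF assms(7,2)] .
  then show ?thesis
  proof (rule has_derivative_transform_within_open[OF _ assms(2,7)])
    show "g y = (\<Sum>n. f n y)" if "y \<in> S" for y
      using g(1)[OF that] by (rule sums_unique)
  qed
qed

text \<open>Bounds are available in basis directions, while the M-test needs all directions.
  Expanding \<open>h\<close> in the basis costs the dimension as a factor.\<close>

lemma norm_frechet_derivative_le:
  assumes "f differentiable (at x)" "\<And>b. b \<in> Basis \<Longrightarrow> norm (pderiv_at b f x) \<le> M"
  shows "norm (frechet_derivative f (at x) (h::'a::euclidean_space)) \<le> real DIM('a) * M * norm h"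
proof -
  let ?D = "frechet_derivative f (at x)"
  have lin: "linear ?D" using assms(1) by (rule linear_frechet_derivative)
  have "norm (?D h) = norm (?D (\<Sum>b\<in>Basis. (h \<bullet> b) *\<^sub>R b))" by (simp add: euclidean_representation)
  also have "\<dots> = norm (\<Sum>b\<in>Basis. (h \<bullet> b) *\<^sub>R ?D b)"
    by (simp add: linear_sum[OF lin] linear_scale[OF lin])
  also have "\<dots> \<le> (\<Sum>b\<in>(Basis::'a set). norm h * M)"
    using assms(2) by (intro sum_norm_le) (auto intro!: mult_mono' Basis_le_norm)
  finally show ?thesis by (simp add: mult_ac)
qed

lemma iter_deriv_diff:
  assumes "smooth f" "smooth g" "set bs \<subseteq> Basis"
  shows "iter_deriv bs (\<lambda>x. f x - g x) = (\<lambda>x. iter_deriv bs f x - iter_deriv bs g x)"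
  using iter_deriv_add[OF assms(1) smooth_cmult[OF assms(2), of "-1"] assms(3)]
  by (simp add: iter_deriv_cmult[OF assms(2,3), of "-1", simplified])

text \<open>A single bound for all orders up to \<open>N\<close>, without the weights
  \<open>norm x ^ k\<close> of the Schwartz seminorms: on functions supported in a fixed ball these
  weights cost only a constant factor.\<close>

definition bounded_derivs :: "nat \<Rightarrow> real \<Rightarrow> ('a::euclidean_space \<Rightarrow> complex) \<Rightarrow> bool" where
  "bounded_derivs N M f \<longleftrightarrow>
     (\<forall>bs x. length bs \<le> N \<longrightarrow> set bs \<subseteq> Basis \<longrightarrow> norm (iter_deriv bs f x) \<le> M)"

lemma bounded_derivsD:
  "bounded_derivs N M f \<Longrightarrow> length bs \<le> N \<Longrightarrow> set bs \<subseteq> Basis \<Longrightarrow> norm (iter_deriv bs f x) \<le> M"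
  by (simp add: bounded_derivs_def)

text \<open>Differentiating the series of derivatives of a given order uses the majorant for the
  next order, so one summable majorant for each order suffices.\<close>

lemma
  fixes g :: "nat \<Rightarrow> 'a::euclidean_space \<Rightarrow> complex"
  assumes sm: "\<And>i. smooth (g i)"
    and bd: "\<And>N. \<exists>M. summable M \<and> (\<forall>i. bounded_derivs N (M i) (g i))"
  shows smooth_suminf: "smooth (\<lambda>x. \<Sum>i. g i x)"
    and iter_deriv_suminf:
      "set bs \<subseteq> Basis \<Longrightarrow> iter_deriv bs (\<lambda>x. \<Sum>i. g i x) = (\<lambda>x. \<Sum>i. iter_deriv bs (g i) x)"
proof -
  have D: "((\<lambda>x. \<Sum>i. iter_deriv bs (g i) x) has_derivative
      (\<lambda>h. \<Sum>i. frechet_derivative (iter_deriv bs (g i)) (at x) h)) (at x)"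
    if bs: "set bs \<subseteq> Basis" for bs x
  proof -
    from bd[of "Suc (length bs)"]
    obtain M where "summable M \<and> (\<forall>i. bounded_derivs (Suc (length bs)) (M i) (g i))" ..
    then have M: "summable M" "\<And>i. bounded_derivs (Suc (length bs)) (M i) (g i)"
      by simp_all
    have d: "iter_deriv bs (g i) differentiable (at x)" for i x
      using sm bs unfolding smooth_def by simp
    show ?thesis
    proof (rule has_derivative_suminf[where S = UNIV
          and f = "\<lambda>i. iter_deriv bs (g i)"
          and f' = "\<lambda>i x. frechet_derivative (iter_deriv bs (g i)) (at x)"
          and M = "\<lambda>i. real DIM('a) * M i"])
      fix i x h
      show "(iter_deriv bs (g i) has_derivative frechet_derivative (iter_deriv bs (g i)) (at x)) (at x)"
        using d[unfolded frechet_derivative_works] .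
      show "norm (frechet_derivative (iter_deriv bs (g i)) (at x) h) \<le> real DIM('a) * M i * norm h"
        using d
      proof (rule norm_frechet_derivative_le)
        fix b :: 'a assume "b \<in> Basis"
        then show "norm (pderiv_at b (iter_deriv bs (g i)) x) \<le> M i"
          using bounded_derivsD[OF M(2), of "b # bs"] bs by simp
      qed
    next
      fix x
      show "summable (\<lambda>i. iter_deriv bs (g i) x)"
        using bounded_derivsD[OF M(2), of bs] bs by (intro summable_comparison_test'[OF M(1)]) simp
    qed (simp_all add: summable_mult M(1))
  qed
  have E: "iter_deriv bs (\<lambda>x. \<Sum>i. g i x) = (\<lambda>x. \<Sum>i. iter_deriv bs (g i) x)"
    if "set bs \<subseteq> Basis" for bs
    using that
  proof (induction bs)
    case (Cons b bs)
    then have bs: "set bs \<subseteq> Basis" by simp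
    have "pderiv_at b (\<lambda>x. \<Sum>i. iter_deriv bs (g i) x) = (\<lambda>x. \<Sum>i. iter_deriv (b # bs) (g i) x)"
      by (rule ext) (simp add: pderiv_eqI[OF D[OF bs]])
    then show ?case by (simp add: Cons.IH[OF bs])
  qed simp
  show "set bs \<subseteq> Basis \<Longrightarrow>
      iter_deriv bs (\<lambda>x. \<Sum>i. g i x) = (\<lambda>x. \<Sum>i. iter_deriv bs (g i) x)"
    by (rule E)
  show "smooth (\<lambda>x. \<Sum>i. g i x)"
    unfolding smooth_def
  proof (intro allI impI)
    fix bs :: "'a list" and x assume bs: "set bs \<subseteq> Basis"
    show "iter_deriv bs (\<lambda>x. \<Sum>i. g i x) differentiable (at x)"
      unfolding E[OF bs] using D[OF bs] by (rule differentiableI)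
  qed
qed

section \<open>Tempered distributions on functions supported in a fixed ball\<close>

text \<open>The strict inequality describes an open set, so vanishing there passes to
  derivatives.\<close>

lemma iter_deriv_eq_0_outside:
  assumes "\<And>x. R < norm x \<Longrightarrow> f x = 0" "R < norm x"
  shows "iter_deriv bs f x = 0"
  using assms(2)
proof (induction bs arbitrary: x)
  case Nil
  then show ?case using assms(1) by simp
next
  case (Cons b bs)
  have "open {x::'a. R < norm x}"
    by (intro open_Collect_less continuous_intros)
  then have "(iter_deriv bs f has_derivative (\<lambda>h. 0)) (at x)"
    by (rule has_derivative_transform_within_open[OF has_derivative_const]) (use Cons in auto)
  from pderiv_eqI[OF this] show ?case by simp
qed

text \<open>Each derivative is bounded on the compact ball and zero outside. Only finitely many
  lists of basis vectors have length at most \<open>N\<close>, and the sum of their bounds is a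
  common bound.\<close>

lemma bounded_derivs_exists:
  fixes f :: "'a::euclidean_space \<Rightarrow> complex"
  assumes "smooth f" "\<And>x. R < norm x \<Longrightarrow> f x = 0"
  shows "\<exists>M\<ge>0. bounded_derivs N M f"
proof -
  have ex: "\<exists>B. \<forall>x. norm (iter_deriv bs f x) \<le> B" if "set bs \<subseteq> Basis" for bs
  proof -
    have "continuous_on (cball 0 R) (iter_deriv bs f)"
      using assms(1) that unfolding smooth_def
      by (intro continuous_at_imp_continuous_on ballI differentiable_imp_continuous_within) simp
    then have "bounded (iter_deriv bs f ` cball 0 R)"
      by (intro compact_imp_bounded compact_continuous_image compact_cball)
    then obtain B where B: "B > 0" "\<And>x. norm x \<le> R \<Longrightarrow> norm (iter_deriv bs f x) \<le> B"
      by (auto simp: bounded_pos)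
    have "norm (iter_deriv bs f x) \<le> B" for x
      using B iter_deriv_eq_0_outside[where f = f and R = R and x = x and bs = bs] assms(2)
      by (cases "norm x \<le> R") auto
    then show ?thesis by blast
  qed
  define B where "B bs = (SOME B. \<forall>x. norm (iter_deriv bs f x) \<le> B)" for bs
  have B: "norm (iter_deriv bs f x) \<le> B bs" if "set bs \<subseteq> Basis" for bs x
    unfolding B_def using someI_ex[OF ex[OF that]] by blast
  define L where "L = {bs. set bs \<subseteq> (Basis :: 'a set) \<and> length bs \<le> N}"
  have fin: "finite L" unfolding L_def by (rule finite_lists_length_le) simp
  have B0: "0 \<le> B bs" if "bs \<in> L" for bs
    using B[of bs 0] that norm_ge_zero order_trans unfolding L_def by blast
  have "bounded_derivs N (\<Sum>bs\<in>L. B bs) f"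
    unfolding bounded_derivs_def
  proof (intro allI impI)
    fix bs :: "'a list" and x assume l: "length bs \<le> N" "set bs \<subseteq> Basis"
    have "norm (iter_deriv bs f x) \<le> B bs" using B l by simp
    also have "\<dots> \<le> (\<Sum>bs\<in>L. B bs)"
      by (rule member_le_sum[OF _ _ fin]) (use l B0 in \<open>auto simp: L_def\<close>)
    finally show "norm (iter_deriv bs f x) \<le> (\<Sum>bs\<in>L. B bs)" .
  qed
  then show ?thesis using B0 sum_nonneg by blast
qed

lemma weighted_iter_deriv_le:
  assumes "bounded_derivs N M f" "\<And>x. R < norm x \<Longrightarrow> f x = 0" "1 \<le> R" "0 \<le> M"
    and "k \<le> K" "length bs \<le> N" "set bs \<subseteq> Basis"
  shows "norm x ^ k * norm (iter_deriv bs f x) \<le> R ^ K * M"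
proof (cases "R < norm x")
  case True
  have "iter_deriv bs f x = 0" using assms(2) True by (rule iter_deriv_eq_0_outside)
  then show ?thesis using assms(3,4) by simp
next
  case False
  have "norm x ^ k \<le> R ^ k" using False by (intro power_mono) auto
  also have "\<dots> \<le> R ^ K" using assms(3,5) by (intro power_increasing)
  finally have "norm x ^ k \<le> R ^ K" .
  then show ?thesis
    using bounded_derivsD[OF assms(1,6,7)] assms(3) by (intro mult_mono) auto
qed

lemma schwartz_compact_support:
  fixes f :: "'a::euclidean_space \<Rightarrow> complex"
  assumes "smooth f" "\<And>x. R < norm x \<Longrightarrow> f x = 0" "1 \<le> R"
  shows "f \<in> schwartz"
  unfolding schwartz_def
proof (intro CollectI conjI allI impI)
  show "smooth f" by fact
  fix k and bs :: "'a list" assume bs: "set bs \<subseteq> Basis"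
  obtain M where M: "0 \<le> M" "bounded_derivs (length bs) M f"
    using bounded_derivs_exists[of f R "length bs"] assms(1,2) by blast
  show "bdd_above (range (\<lambda>x. norm x ^ k * norm (iter_deriv bs f x)))"
  proof (rule bdd_aboveI2)
    show "norm x ^ k * norm (iter_deriv bs f x) \<le> R ^ k * M" for x
      using weighted_iter_deriv_le[OF M(2) assms(2,3) M(1) order_refl order_refl bs] by simp
  qed
qed

text \<open>Continuity at the zero function gives a neighbourhood on which
  \<open>norm (U g) < 1\<close>, and homogeneity turns this into a linear estimate. For supports in
  one ball, bounds on derivatives control all seminorms involved.\<close>

lemma tempered_distribution_bound:
  fixes U :: "('a::euclidean_space \<Rightarrow> complex) \<Rightarrow> complex"
  assumes U: "tempered_distribution U" and R: "1 \<le> R"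
  obtains N C where "0 \<le> C"
    "\<And>g M. smooth g \<Longrightarrow> (\<And>x. R < norm x \<Longrightarrow> g x = 0) \<Longrightarrow> 0 \<le> M \<Longrightarrow> bounded_derivs N M g \<Longrightarrow>
       norm (U g) \<le> C * M"
proof -
  have z: "(\<lambda>x::'a. 0) \<in> schwartz"
    by (rule schwartz_compact_support[of _ 1]) auto
  have scale: "U (\<lambda>x. c * f x) = c * U f" if "f \<in> schwartz" for c f
    using U that unfolding tempered_distribution_def by blast
  have U0: "U (\<lambda>x. 0) = 0" using scale[OF z, of 0] by simp
  have cont: "\<forall>f\<in>schwartz. \<forall>\<epsilon>>0. \<exists>N. \<exists>\<delta>>0. \<forall>g\<in>schwartz.
        (\<forall>k bs. k \<le> N \<and> length bs \<le> N \<and> set bs \<subseteq> Basis \<longrightarrow>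
           schwartz_seminorm k bs (\<lambda>x. g x - f x) < \<delta>) \<longrightarrow> norm (U g - U f) < \<epsilon>"
    using U unfolding tempered_distribution_def by (elim conjE)
  have "\<exists>N. \<exists>\<delta>>0. \<forall>g\<in>schwartz.
      (\<forall>k bs. k \<le> N \<and> length bs \<le> N \<and> set bs \<subseteq> Basis \<longrightarrow> schwartz_seminorm k bs g < \<delta>) \<longrightarrow>
      norm (U g) < 1"
    using cont[rule_format, OF z zero_less_one] by (simp add: U0)
  then obtain N \<delta> where \<delta>: "0 < \<delta>" and N': "\<forall>g\<in>schwartz.
      (\<forall>k bs. k \<le> N \<and> length bs \<le> N \<and> set bs \<subseteq> Basis \<longrightarrow> schwartz_seminorm k bs g < \<delta>) \<longrightarrow>
      norm (U g) < 1" by (elim exE conjE)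
  have N: "norm (U g) < 1" if "g \<in> schwartz"
    "\<And>k bs. k \<le> N \<Longrightarrow> length bs \<le> N \<Longrightarrow> set bs \<subseteq> Basis \<Longrightarrow> schwartz_seminorm k bs g < \<delta>" for g
    using N' that by simp
  \<comment> \<open>The factor 2 leaves room for the strict inequality: after rescaling, the
    seminorms are at most \<open>\<delta> / 2\<close>.\<close>
  define C where "C = 2 * R ^ N / \<delta>"
  have C: "0 < C" using \<delta> R by (simp add: C_def)
  have le: "norm (U g) \<le> C * M"
    if g: "smooth g" "\<And>x. R < norm x \<Longrightarrow> g x = 0" and M: "0 < M" "bounded_derivs N M g" for g M
  proof -
    define c where "c = 1 / (C * M)"
    have c: "0 < c" using C M by (simp add: c_def)
    have cM: "c * M * R ^ N = \<delta> / 2" using C M R \<delta> by (simp add: c_def C_def)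
    have gs: "g \<in> schwartz" using g R by (rule schwartz_compact_support)
    let ?h = "\<lambda>x. of_real c * g x"
    have sh: "smooth ?h" using g(1) by (rule smooth_cmult)
    have h0: "\<And>x. R < norm x \<Longrightarrow> ?h x = 0" using g(2) by simp
    have hb: "bounded_derivs N (c * M) ?h"
      unfolding bounded_derivs_def
    proof (intro allI impI)
      fix bs :: "'a list" and x assume "length bs \<le> N" "set bs \<subseteq> Basis"
      then show "norm (iter_deriv bs ?h x) \<le> c * M"
        using bounded_derivsD[OF M(2)] c by (simp add: iter_deriv_cmult[OF g(1)] norm_mult)
    qed
    have "norm (U ?h) < 1"
    proof (rule N)
      show "?h \<in> schwartz" using sh h0 R by (rule schwartz_compact_support)
      fix k and bs :: "'a list" assume *: "k \<le> N" "length bs \<le> N" "set bs \<subseteq> Basis"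
      have "schwartz_seminorm k bs ?h \<le> R ^ N * (c * M)"
        unfolding schwartz_seminorm_def
        using weighted_iter_deriv_le[OF hb h0 R _ *] c M by (intro cSUP_least) auto
      also have "\<dots> < \<delta>" using cM \<delta> by (simp add: mult_ac)
      finally show "schwartz_seminorm k bs ?h < \<delta>" .
    qed
    then have "c * norm (U g) < 1" using c by (simp add: scale[OF gs] norm_mult)
    then show ?thesis using C M by (simp add: c_def field_simps)
  qed
  \<comment> \<open>The rescaling divides by \<open>M\<close>, so \<open>M = 0\<close> is still
    open. It is reached by enlarging the bound to \<open>M + e / C\<close> and letting
    \<open>e\<close> be arbitrarily small.\<close>
  have "norm (U g) \<le> C * M"
    if g: "smooth g" "\<And>x. R < norm x \<Longrightarrow> g x = 0" and M: "0 \<le> M" "bounded_derivs N M g" for g M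
  proof (rule field_le_epsilon)
    fix e :: real assume e: "0 < e"
    have "bounded_derivs N (M + e / C) g"
      unfolding bounded_derivs_def
    proof (intro allI impI)
      fix bs :: "'a list" and x assume "length bs \<le> N" "set bs \<subseteq> Basis"
      then have "norm (iter_deriv bs g x) \<le> M" by (rule bounded_derivsD[OF M(2)])
      also have "M \<le> M + e / C" using e C by simp
      finally show "norm (iter_deriv bs g x) \<le> M + e / C" .
    qed
    moreover have "0 < M + e / C" using M e C by (simp add: add_nonneg_pos)
    ultimately have "norm (U g) \<le> C * (M + e / C)" using g by (intro le)
    then show "norm (U g) \<le> C * M + e" using C by (simp add: distrib_left)
  qed
  with less_imp_le[OF C] show thesis by (rule that)
qed

text \<open>The remainder after \<open>n\<close> terms is again smooth with support in the same
  ball, and its derivatives are at most the tail of the majorant. The linear estimate for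
  \<open>U\<close> then sends it to 0.\<close>

lemma tempered_distribution_sums:
  fixes U :: "('a::euclidean_space \<Rightarrow> complex) \<Rightarrow> complex"
  assumes U: "tempered_distribution U"
    and R: "1 \<le> R"
    and sm: "\<And>i. smooth (g i)"
    and bd: "\<And>N. \<exists>M. summable M \<and> (\<forall>i. bounded_derivs N (M i) (g i))"
    and z: "\<And>i x. R < norm x \<Longrightarrow> g i x = 0"
  shows "(\<lambda>i. U (g i)) sums U (\<lambda>x. \<Sum>i. g i x)"
proof -
  have add: "U (\<lambda>x. f x + h x) = U f + U h" if "f \<in> schwartz" "h \<in> schwartz" for f h
    using U that unfolding tempered_distribution_def by blast
  have scale: "U (\<lambda>x. c * f x) = c * U f" if "f \<in> schwartz" for c f
    using U that unfolding tempered_distribution_def by blast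
  obtain N C where C: "0 \<le> C" "\<And>g M. smooth g \<Longrightarrow> (\<And>x. R < norm x \<Longrightarrow> g x = 0) \<Longrightarrow> 0 \<le> M \<Longrightarrow>
      bounded_derivs N M g \<Longrightarrow> norm (U g) \<le> C * M"
    by (rule tempered_distribution_bound[OF U R]) blast
  from bd[of N] obtain M where "summable M \<and> (\<forall>i. bounded_derivs N (M i) (g i))" ..
  then have M: "summable M" "\<And>i. bounded_derivs N (M i) (g i)"
    by simp_all
  let ?G = "\<lambda>x. \<Sum>i. g i x"
  let ?T = "\<lambda>n. suminf M - (\<Sum>i<n. M i)"
  have sG: "smooth ?G" using sm bd by (rule smooth_suminf)
  have sS: "smooth (\<lambda>x. \<Sum>i<n. g i x)" for n by (intro smooth_sum sm)
  have Ssch: "(\<lambda>x. \<Sum>i<n. g i x) \<in> schwartz" for n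
    using sS z by (intro schwartz_compact_support[OF _ _ R]) auto
  have gsch: "g i \<in> schwartz" for i
    using sm z R by (rule schwartz_compact_support)
  have U0: "U (\<lambda>x. 0) = 0" using scale[OF gsch, of 0] by simp
  have US: "U (\<lambda>x. \<Sum>i<n. g i x) = (\<Sum>i<n. U (g i))" for n
  proof (induction n)
    case (Suc n)
    then show ?case using add[OF Ssch gsch] by simp
  qed (simp add: U0)
  have le: "norm (U ?G - (\<Sum>i<n. U (g i))) \<le> C * ?T n" for n
  proof -
    let ?h = "\<lambda>x. ?G x - (\<Sum>i<n. g i x)"
    have sh: "smooth ?h" by (rule smooth_diff[OF sG sS])
    have hz: "\<And>x. R < norm x \<Longrightarrow> ?h x = 0" by (simp add: z)
    have hb: "bounded_derivs N (?T n) ?h"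
      unfolding bounded_derivs_def
    proof (intro allI impI)
      fix bs :: "'a list" and x assume l: "length bs \<le> N" and bs: "set bs \<subseteq> Basis"
      have "iter_deriv bs ?h x = (\<Sum>i. iter_deriv bs (g i) x) - (\<Sum>i<n. iter_deriv bs (g i) x)"
        by (simp add: iter_deriv_diff[OF sG sS bs] iter_deriv_suminf[OF sm bd bs]
            iter_deriv_sum[OF sm bs])
      also have "norm \<dots> \<le> ?T n"
        using bounded_derivsD[OF M(2) l bs] by (rule norm_suminf_diff_partial_le[OF M(1)])
      finally show "norm (iter_deriv bs ?h x) \<le> ?T n" .
    qed
    \<comment> \<open>The tail dominates a norm, hence it is nonnegative, as the estimate for
      \<open>U\<close> requires.\<close>
    have "norm (iter_deriv [] ?h 0) \<le> ?T n"
      by (rule bounded_derivsD[OF hb]) simp_all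
    then have "0 \<le> ?T n" by (rule order_trans[OF norm_ge_zero])
    with sh hz have "norm (U ?h) \<le> C * ?T n"
      using hb by (rule C(2))
    moreover have "?h \<in> schwartz" using sh hz R by (rule schwartz_compact_support)
    from add[OF this Ssch[of n]] have "U ?G = U ?h + (\<Sum>i<n. U (g i))"
      by (simp add: US)
    ultimately show ?thesis by simp
  qed
  have "(\<lambda>n. C * ?T n) \<longlonglongrightarrow> 0"
    by (rule tendsto_mult_right_zero[OF suminf_diff_partial_tendsto_0[OF M(1)]])
  then have "(\<lambda>n. U ?G - (\<Sum>i<n. U (g i))) \<longlonglongrightarrow> 0"
    by (rule Lim_null_comparison[OF always_eventually[OF allI[OF le]]])
  from tendsto_diff[OF tendsto_const[of "U ?G"] this] show ?thesis
    unfolding sums_def by simp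
qed

section \<open>Double series\<close>

text \<open>\<open>spherical\<close> is written with \<open>infsum\<close>, power series with
  \<open>suminf\<close>; absolute convergence reconciles them.\<close>

lemma summable_norm_imp_infsum:
  fixes a :: "nat \<Rightarrow> 'a::banach"
  assumes "summable (\<lambda>n. norm (a n))"
  shows "infsum a UNIV = suminf a"
  using norm_summable_imp_has_sum[OF assms summable_sums[OF summable_norm_cancel[OF assms]]]
  by (rule infsumI)

text \<open>The pairs of indices are enumerated by \<open>prod_decode\<close>, so that a double series is an
  ordinary series.\<close>

lemma sums_prod_decode:
  fixes a b :: "nat \<Rightarrow> 'a::{banach, real_normed_field}"
  assumes a: "summable (\<lambda>n. norm (a n))" and b: "summable (\<lambda>n. norm (b n))"
  shows "(\<lambda>i. a (fst (prod_decode i)) * b (snd (prod_decode i))) sums (suminf a * suminf b)"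
    and "summable (\<lambda>i. norm (a (fst (prod_decode i)) * b (snd (prod_decode i))))"
proof -
  let ?f = "\<lambda>p. a (fst p) * b (snd p)"
  have an: "(\<lambda>n. norm (a n)) summable_on UNIV"
    using a by (simp add: summable_on_UNIV_nonneg_real_iff)
  have bn: "(\<lambda>n. norm (b n)) summable_on UNIV"
    using b by (simp add: summable_on_UNIV_nonneg_real_iff)
  have abs: "(\<lambda>p. norm (?f p)) summable_on (UNIV \<times> UNIV)"
    unfolding Infinite_Sum.abs_summable_on_Sigma_iff
  proof (intro conjI ballI)
    show "(\<lambda>y. norm (?f (x, y))) summable_on UNIV" for x
      using summable_on_cmult_right[OF bn, of "norm (a x)"] by (simp add: norm_mult)
    have "(\<lambda>x. infsum (\<lambda>y. norm (?f (x, y))) UNIV) = (\<lambda>x. norm (a x) * infsum (\<lambda>y. norm (b y)) UNIV)"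
      by (simp add: norm_mult infsum_cmult_right')
    then show "(\<lambda>x. norm (infsum (\<lambda>y. norm (?f (x, y))) UNIV)) summable_on UNIV"
      using summable_on_cmult_left[OF an, of "infsum (\<lambda>y. norm (b y)) UNIV"]
      by (simp add: infsum_nonneg)
  qed
  have sum: "?f summable_on (UNIV \<times> UNIV)"
    using abs by (rule abs_summable_summable)
  have "infsum ?f (UNIV \<times> UNIV) = infsum (\<lambda>x. infsum (\<lambda>y. ?f (x, y)) UNIV) UNIV"
    using infsum_Sigma_banach[OF sum] by simp
  also have "\<dots> = infsum a UNIV * infsum b UNIV"
    by (simp add: infsum_cmult_right' infsum_cmult_left')
  also have "\<dots> = suminf a * suminf b"
    by (simp add: summable_norm_imp_infsum a b)
  finally have "(?f has_sum (suminf a * suminf b)) UNIV"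
    using has_sum_infsum[OF sum] by simp
  then have "((\<lambda>i. ?f (prod_decode i)) has_sum (suminf a * suminf b)) UNIV"
    using has_sum_reindex_bij_betw[OF bij_prod_decode, of ?f] by simp
  then show "(\<lambda>i. ?f (prod_decode i)) sums (suminf a * suminf b)"
    by (rule has_sum_imp_sums)
  have "(\<lambda>p. norm (?f p)) summable_on UNIV" using abs by simp
  then have "(\<lambda>i. norm (?f (prod_decode i))) summable_on UNIV"
    using summable_on_reindex_bij_betw[OF bij_prod_decode, of "\<lambda>p. norm (?f p)"] by simp
  then show "summable (\<lambda>i. norm (?f (prod_decode i)))"
    by (rule summable_on_imp_summable)
qed

text \<open>The Taylor coefficients of exp (A (v + w)). They serve as universal majorant because
  evaluation at points of modulus r only replaces A by r A.\<close>

definition exp_weight :: "real \<Rightarrow> nat \<times> nat \<Rightarrow> real" where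
  "exp_weight A p = A ^ fst p / fact (fst p) * (A ^ snd p / fact (snd p))"

lemma exp_weight_nonneg: "0 \<le> A \<Longrightarrow> 0 \<le> exp_weight A p"
  by (simp add: exp_weight_def)

lemma exp_weight_mult:
  "r ^ fst p * r ^ snd p * exp_weight A p = exp_weight (r * A) p"
  by (simp add: exp_weight_def power_mult_distrib)

lemma summable_power_div_fact: "summable (\<lambda>n. x ^ n / fact n)" for x :: real
  using summable_exp_generic[of x] by (simp add: divide_inverse mult.commute)

lemma summable_exp_weight:
  assumes "0 \<le> A"
  shows "summable (\<lambda>i. exp_weight A (prod_decode i))"
proof -
  have "summable (\<lambda>n. norm (A ^ n / fact n))"
    using assms summable_power_div_fact[of A] by simp
  from sums_prod_decode(2)[OF this this] show ?thesis
    using assms by (simp add: exp_weight_def)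
qed

lemma norm_power_mult_exp_weight_le:
  fixes a b :: "'a::real_normed_div_algebra"
  assumes "norm a \<le> r" "norm b \<le> r" "0 \<le> A"
  shows "norm (a ^ fst p * b ^ snd p) * exp_weight A p \<le> exp_weight (r * A) p"
  unfolding exp_weight_mult[symmetric] norm_mult norm_power
  using assms order_trans[OF norm_ge_zero assms(1)]
  by (intro mult_right_mono mult_mono power_mono) (auto intro: exp_weight_nonneg)

text \<open>The factor n from differentiation is absorbed by n \<le> 2^n, so a derivative also fits
  under an exponential weight. \<open>1 \<le> r\<close> allows the lost power to be
  restored.\<close>

lemma nat_mult_power_pred_le:
  fixes x :: "'a::real_normed_field"
  assumes "norm x \<le> r" "1 \<le> r"
  shows "norm (of_nat n * x ^ (n - 1)) \<le> 2 ^ n * r ^ n"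
proof -
  have "norm (of_nat n * x ^ (n - 1)) = real n * norm x ^ (n - 1)"
    by (simp add: norm_mult norm_power)
  also have "\<dots> \<le> 2 ^ n * r ^ n"
  proof (rule mult_mono)
    show "real n \<le> 2 ^ n" using of_nat_less_two_power[of n, where 'a = real] by simp
    have "norm x ^ (n - 1) \<le> r ^ (n - 1)" using assms by (intro power_mono) auto
    also have "\<dots> \<le> r ^ n" using assms by (intro power_increasing) auto
    finally show "norm x ^ (n - 1) \<le> r ^ n" .
  qed simp_all
  finally show ?thesis .
qed

section \<open>Power series in two complex variables\<close>

definition double_series :: "(nat \<Rightarrow> complex) \<Rightarrow> complex \<times> complex \<Rightarrow> complex" where
  "double_series c p =
     (\<Sum>i. fst p ^ fst (prod_decode i) * snd p ^ snd (prod_decode i) * c i)"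

text \<open>The series of termwise derivatives converges normally on every ball. Each termwise
  derivative is complex homogeneous, and so is their sum; this is what separates the complex from
  the real derivative.\<close>

lemma double_series_differentiable:
  assumes c: "\<And>i. norm (c i) \<le> K * exp_weight A (prod_decode i)" and "0 \<le> K" "0 \<le> A"
  shows "\<exists>D. (double_series c has_derivative D) (at p) \<and> (\<forall>e u v. D (e * u, e * v) = e * D (u, v))"
proof -
  define J L where "J i = fst (prod_decode i)" and "L i = snd (prod_decode i)" for i
  \<comment> \<open>The added 1 puts \<open>p\<close> inside the open ball and also ensures
    \<open>1 \<le> r\<close>.\<close>
  define r where "r = norm p + 1"
  have r: "1 \<le> r" and p: "p \<in> ball 0 r" by (simp_all add: r_def)
  define f where "f i q = fst q ^ J i * snd q ^ L i * c i" for i and q :: "complex \<times> complex"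
  define f' where "f' i q h =
      (fst q ^ J i * (of_nat (L i) * snd q ^ (L i - 1) * snd h)
       + of_nat (J i) * fst q ^ (J i - 1) * fst h * snd q ^ L i) * c i"
    for i and q h :: "complex \<times> complex"
  \<comment> \<open>The outer 2 counts the two summands of the product rule; the inner 2 comes from
    n \<le> 2^n.\<close>
  define M where "M i = 2 * K * exp_weight (2 * r * A) (prod_decode i)" for i
  have sM: "summable M"
    unfolding M_def using r \<open>0 \<le> A\<close> by (intro summable_mult summable_exp_weight) simp
  have comp: "norm (fst q) \<le> norm q" "norm (snd q) \<le> norm q" for q :: "complex \<times> complex"
    using norm_fst_le[of "fst q" "snd q"] norm_snd_le[of "snd q" "fst q"] by simp_all
  have fst_le: "norm (fst q) \<le> r" and snd_le: "norm (snd q) \<le> r" if "q \<in> ball 0 r" for q :: "complex \<times> complex"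
    using comp[of q] that by simp_all
  have bnd: "r ^ J i * r ^ L i * 2 ^ J i * 2 ^ L i * norm (c i) \<le> M i / 2" for i
  proof -
    have "r ^ J i * r ^ L i * 2 ^ J i * 2 ^ L i * norm (c i)
        \<le> r ^ J i * r ^ L i * 2 ^ J i * 2 ^ L i * (K * exp_weight A (prod_decode i))"
      using r by (intro mult_left_mono c) simp
    also have "\<dots> = K * ((2 * r) ^ J i * (2 * r) ^ L i * exp_weight A (prod_decode i))"
      by (simp add: power_mult_distrib mult_ac)
    also have "\<dots> = K * exp_weight (2 * r * A) (prod_decode i)"
      unfolding J_def L_def exp_weight_mult ..
    finally show ?thesis by (simp add: M_def)
  qed
  have f'_le: "norm (f' i q h) \<le> M i * norm h" if q: "q \<in> ball 0 r" for i q h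
  proof -
    have A: "norm (fst q ^ J i * (of_nat (L i) * snd q ^ (L i - 1) * snd h))
        \<le> r ^ J i * (2 ^ L i * r ^ L i * norm h)"
      unfolding norm_mult[of "fst q ^ J i"] norm_mult[of _ "snd h"] norm_power[of "fst q"]
      using r comp(2)[of h] fst_le[OF q] nat_mult_power_pred_le[OF snd_le[OF q] r]
      by (intro mult_mono power_mono) auto
    also have "\<dots> = r ^ J i * r ^ L i * 2 ^ L i * norm h" by (simp add: mult_ac)
    also have "\<dots> \<le> r ^ J i * r ^ L i * 2 ^ J i * 2 ^ L i * norm h"
      using r by (intro mult_right_mono) simp_all
    finally have 1: "norm (fst q ^ J i * (of_nat (L i) * snd q ^ (L i - 1) * snd h))
        \<le> r ^ J i * r ^ L i * 2 ^ J i * 2 ^ L i * norm h" .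
    have "norm (of_nat (J i) * fst q ^ (J i - 1) * fst h * snd q ^ L i)
        \<le> 2 ^ J i * r ^ J i * norm h * r ^ L i"
      unfolding norm_mult[of _ "snd q ^ L i"] norm_mult[of _ "fst h"] norm_power[of "snd q"]
      using r comp(1)[of h] snd_le[OF q] nat_mult_power_pred_le[OF fst_le[OF q] r]
      by (intro mult_mono power_mono) auto
    also have "\<dots> = r ^ J i * r ^ L i * 2 ^ J i * norm h" by (simp add: mult_ac)
    also have "\<dots> \<le> r ^ J i * r ^ L i * 2 ^ J i * 2 ^ L i * norm h"
      using r by (intro mult_right_mono) simp_all
    finally have 2: "norm (of_nat (J i) * fst q ^ (J i - 1) * fst h * snd q ^ L i)
        \<le> r ^ J i * r ^ L i * 2 ^ J i * 2 ^ L i * norm h" .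
    have "norm (f' i q h) \<le> (2 * (r ^ J i * r ^ L i * 2 ^ J i * 2 ^ L i * norm h)) * norm (c i)"
      unfolding f'_def norm_mult[of _ "c i"] mult_2
      by (rule mult_right_mono[OF norm_triangle_mono[OF 1 2] norm_ge_zero])
    also have "\<dots> = 2 * (r ^ J i * r ^ L i * 2 ^ J i * 2 ^ L i * norm (c i)) * norm h"
      by (simp add: mult_ac)
    also have "\<dots> \<le> 2 * (M i / 2) * norm h"
      using bnd[of i] by (intro mult_right_mono mult_left_mono) simp_all
    finally show ?thesis by simp
  qed
  have f_le: "norm (f i q) \<le> M i" if q: "q \<in> ball 0 r" for i q
  proof -
    have "norm (f i q) \<le> r ^ J i * r ^ L i * norm (c i)"
      unfolding f_def norm_mult norm_power using r fst_le[OF q] snd_le[OF q]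
      by (intro mult_mono power_mono) auto
    also have "\<dots> \<le> r ^ J i * r ^ L i * 2 ^ J i * 2 ^ L i * norm (c i)"
      using r by (intro mult_right_mono) (simp_all add: mult.assoc mult_le_cancel_left1 flip: power_add)
    also have "\<dots> \<le> M i / 2" by (rule bnd)
    also have "\<dots> \<le> M i" using norm_ge_zero[of "c i"] bnd[of i] r
      by (smt (verit) field_sum_of_halves mult_nonneg_nonneg zero_le_power)
    finally show ?thesis .
  qed
  have D: "((\<lambda>q. \<Sum>i. f i q) has_derivative (\<lambda>h. \<Sum>i. f' i p h)) (at p)"
  proof (rule has_derivative_suminf[where S = "ball 0 r" and f = f and f' = f' and M = M])
    show "(f i has_derivative f' i q) (at q)" for i q
      unfolding f_def f'_def
      by (rule derivative_eq_intros refl)+ (simp add: fun_eq_iff algebra_simps)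
    show "summable (\<lambda>n. f n q)" if "q \<in> ball 0 r" for q
      by (rule summable_comparison_test'[OF sM]) (rule f_le[OF that])
  qed (use p in \<open>simp_all add: f'_le sM\<close>)
  have sf': "summable (\<lambda>i. f' i p h)" for h
    by (rule summable_comparison_test'[OF summable_mult2[OF sM]]) (rule f'_le[OF p])
  have "f' i p (e * u, e * v) = e * f' i p (u, v)" for i e u v
    by (simp add: f'_def algebra_simps)
  then have "(\<Sum>i. f' i p (e * u, e * v)) = e * (\<Sum>i. f' i p (u, v))" for e u v
    by (simp add: suminf_mult[OF sf'])
  moreover have "double_series c = (\<lambda>q. \<Sum>i. f i q)"
    by (simp add: double_series_def f_def J_def L_def fun_eq_iff)
  ultimately show ?thesis using D by (intro exI[of _ "\<lambda>h. \<Sum>i. f' i p h"]) simp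
qed

section \<open>The coefficients of the spherical functions\<close>

text \<open>The coefficients are polynomials in (\<xi>, \<lambda>), in general unbounded on the
  plane, so their derivatives are estimated pointwise and the cutoff is brought in
  afterwards.\<close>

definition bounded_derivs_at ::
    "nat \<Rightarrow> real \<Rightarrow> ('a::euclidean_space \<Rightarrow> complex) \<Rightarrow> 'a \<Rightarrow> bool" where
  "bounded_derivs_at N M f x \<longleftrightarrow>
     (\<forall>bs. length bs \<le> N \<longrightarrow> set bs \<subseteq> Basis \<longrightarrow> norm (iter_deriv bs f x) \<le> M)"

lemma bounded_derivs_atD:
  "bounded_derivs_at N M f x \<Longrightarrow> length bs \<le> N \<Longrightarrow> set bs \<subseteq> Basis \<Longrightarrow> norm (iter_deriv bs f x) \<le> M"
  by (simp add: bounded_derivs_at_def)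

lemma bounded_derivs_at_norm_le: "bounded_derivs_at N M f x \<Longrightarrow> norm (f x) \<le> M"
  using bounded_derivs_atD[of N M f x "[]"] by simp

lemma bounded_derivs_at_nonneg: "bounded_derivs_at N M f x \<Longrightarrow> 0 \<le> M"
  by (rule order_trans[OF norm_ge_zero bounded_derivs_at_norm_le])

lemma bounded_derivs_at_mono:
  assumes "bounded_derivs_at N M f x" "M \<le> M'"
  shows "bounded_derivs_at N M' f x"
  unfolding bounded_derivs_at_def
proof (intro allI impI)
  fix bs :: "'a list" assume "length bs \<le> N" "set bs \<subseteq> Basis"
  then show "norm (iter_deriv bs f x) \<le> M'"
    by (rule order_trans[OF bounded_derivs_atD[OF assms(1)] assms(2)])
qed

lemma bounded_derivs_at_const: "norm c \<le> M \<Longrightarrow> bounded_derivs_at N M (\<lambda>x. c) x"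
  using order_trans[OF norm_ge_zero, of c M] by (auto simp: bounded_derivs_at_def iter_deriv_const)

lemma bounded_derivs_at_mult:
  assumes "smooth f" "smooth g" "bounded_derivs_at N M f x" "bounded_derivs_at N M' g x"
  shows "bounded_derivs_at N (2 ^ N * (M * M')) (\<lambda>x. f x * g x) x"
  unfolding bounded_derivs_at_def
proof (intro allI impI)
  fix bs :: "'a list" assume l: "length bs \<le> N" and bs: "set bs \<subseteq> Basis"
  have "norm (iter_deriv bs (\<lambda>x. f x * g x) x) \<le> 2 ^ length bs * (M * M')"
    using assms(1,2) bs
  proof (rule norm_iter_deriv_mult_le)
    fix cs :: "'a list" assume "length cs \<le> length bs" and cs: "set cs \<subseteq> Basis"
    then have "length cs \<le> N" using l by simp
    from bounded_derivs_atD[OF assms(3) this cs] show "norm (iter_deriv cs f x) \<le> M" .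
    from bounded_derivs_atD[OF assms(4) \<open>length cs \<le> N\<close> cs] show "norm (iter_deriv cs g x) \<le> M'" .
  qed
  also have "\<dots> \<le> 2 ^ N * (M * M')"
    using l bounded_derivs_at_nonneg[OF assms(3)] bounded_derivs_at_nonneg[OF assms(4)]
    by (intro mult_right_mono power_increasing) simp_all
  finally show "norm (iter_deriv bs (\<lambda>x. f x * g x) x) \<le> 2 ^ N * (M * M')" .
qed

lemma bounded_derivs_at_cmult:
  assumes "smooth f" "bounded_derivs_at N M f x"
  shows "bounded_derivs_at N (norm c * M) (\<lambda>x. c * f x) x"
  unfolding bounded_derivs_at_def
proof (intro allI impI)
  fix bs :: "'a list" assume "length bs \<le> N" and bs: "set bs \<subseteq> Basis"
  then have "norm (iter_deriv bs f x) \<le> M" by (rule bounded_derivs_atD[OF assms(2)])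
  then show "norm (iter_deriv bs (\<lambda>x. c * f x) x) \<le> norm c * M"
    by (simp add: iter_deriv_cmult[OF assms(1) bs] norm_mult mult_left_mono)
qed

text \<open>For fixed \<open>N\<close> each new factor costs \<open>2 ^ N\<close>, so the total loss
  is exponential in \<open>k\<close>, not factorial.\<close>

lemma bounded_derivs_at_prod:
  assumes "\<And>d. smooth (f d)" "\<And>d. bounded_derivs_at N (M d) (f d) x"
  shows "bounded_derivs_at N ((2 ^ N) ^ k * (\<Prod>d<k. M d)) (\<lambda>x. \<Prod>d<k. f d x) x"
proof (induction k)
  case 0
  show ?case by (simp add: bounded_derivs_at_const)
next
  case (Suc k)
  have "bounded_derivs_at N (2 ^ N * (((2 ^ N) ^ k * (\<Prod>d<k. M d)) * M k))
      (\<lambda>x. (\<Prod>d<k. f d x) * f k x) x"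
    by (rule bounded_derivs_at_mult[OF smooth_prod[OF assms(1)] assms(1) Suc.IH assms(2)])
  then show ?case by (simp add: mult_ac)
qed

text \<open>First derivatives are the constants \<open>f b\<close> and higher ones vanish, so one
  bound serves every \<open>N\<close>.\<close>

lemma bounded_derivs_at_linear:
  assumes "bounded_linear f" "norm (f x) \<le> M" "\<And>b. b \<in> Basis \<Longrightarrow> norm (f b) \<le> M"
  shows "bounded_derivs_at N M f x"
  unfolding bounded_derivs_at_def
proof (intro allI impI)
  fix bs :: "'a list" assume bs: "set bs \<subseteq> Basis"
  show "norm (iter_deriv bs f x) \<le> M"
  proof (cases bs rule: rev_cases)
    case Nil
    then show ?thesis using assms(2) by simp
  next
    case (snoc cs b)
    have b: "b \<in> Basis" using bs snoc by simp
    have "0 \<le> M" using assms(2) by (rule order_trans[OF norm_ge_zero])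
    then show ?thesis using assms(3)[OF b]
      by (simp add: snoc iter_deriv_snoc pderiv_bounded_linear[OF assms(1)] iter_deriv_const)
  qed
qed

definition spherical_factor :: "nat \<Rightarrow> nat \<Rightarrow> real \<times> real \<Rightarrow> complex" where
  "spherical_factor n d x = of_real (snd x) * of_nat (2 * d + n) - of_real (fst x)"

text \<open>With the range \<open>d<k\<close>, the index 0 gives the constant 1 that
  \<open>spherical\<close> keeps as a separate summand.\<close>

definition spherical_coeff :: "nat \<Rightarrow> nat \<Rightarrow> real \<times> real \<Rightarrow> complex" where
  "spherical_coeff n k x =
     inverse (pochhammer (of_nat n) k * fact k * 4 ^ k) * (\<Prod>d<k. spherical_factor n d x)"

lemma bounded_linear_spherical_factor: "bounded_linear (spherical_factor n d)"
  unfolding spherical_factor_def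
  by (intro bounded_linear_sub bounded_linear_compose[OF bounded_linear_mult_left]
      bounded_linear_compose[OF bounded_linear_of_real] bounded_linear_fst bounded_linear_snd)

lemma bounded_linear_of_real_snd: "bounded_linear (\<lambda>x::real \<times> real. complex_of_real (snd x))"
  by (intro bounded_linear_compose[OF bounded_linear_of_real] bounded_linear_snd)

lemma smooth_spherical_coeff: "smooth (spherical_coeff n k)"
  unfolding spherical_coeff_def
  by (intro smooth_cmult smooth_prod smooth_bounded_linear bounded_linear_spherical_factor)

lemma norm_spherical_factor_le:
  assumes "1 \<le> n" "norm x \<le> R"
  shows "norm (spherical_factor n d x) \<le> 2 * R * (real n + real d)"
proof -
  have x: "\<bar>fst x\<bar> \<le> norm x" "\<bar>snd x\<bar> \<le> norm x"
    using norm_fst_le[of "fst x" "snd x"] norm_snd_le[of "snd x" "fst x"] by simp_all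
  have "norm (spherical_factor n d x) \<le> \<bar>snd x\<bar> * real (2 * d + n) + \<bar>fst x\<bar>"
    unfolding spherical_factor_def
    by (rule order_trans[OF norm_triangle_ineq4]) (simp add: norm_mult del: of_nat_add of_nat_mult)
  also have "\<dots> \<le> R * real (2 * d + n) + R * 1"
    using x assms(2) by (intro add_mono mult_right_mono) simp_all
  also have "\<dots> = R * (2 * real d + real n + 1)" by (simp add: algebra_simps)
  \<comment> \<open>2 d + n + 1 \<le> 2 (n + d) because n \<ge> 1.\<close>
  also have "\<dots> \<le> R * (2 * (real n + real d))"
    using assms order_trans[OF norm_ge_zero assms(2)] by (intro mult_left_mono) simp_all
  finally show ?thesis by (simp add: mult_ac)
qed

text \<open>The factors \<open>n + d\<close> in the bounds of the \<open>k\<close> factors multiply up to the Pochhammer symbol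
  in the denominator.\<close>

lemma bounded_derivs_at_spherical_coeff:
  assumes n: "1 \<le> n" and x: "norm x \<le> R" and R: "1 \<le> R"
  shows "bounded_derivs_at N ((2 ^ N * (2 * R)) ^ k / fact k) (spherical_coeff n k) x"
proof -
  define P where "P = (\<Prod>d<k. real n + real d)"
  have P: "0 < P" unfolding P_def using n by (intro prod_pos) auto
  have poch: "norm (pochhammer (of_nat n :: complex) k) = P"
  proof -
    have "norm (of_nat n + of_nat d :: complex) = real n + real d" for d
      by (metis norm_of_nat of_nat_add)
    then show ?thesis by (simp add: P_def pochhammer_prod prod_norm[symmetric] atLeast0LessThan)
  qed
  have "bounded_derivs_at N (2 * R * (real n + real d)) (spherical_factor n d) x" for d
  proof (rule bounded_derivs_at_linear[OF bounded_linear_spherical_factor])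
    show "norm (spherical_factor n d x) \<le> 2 * R * (real n + real d)"
      using n x by (rule norm_spherical_factor_le)
    \<comment> \<open>Basis vectors have norm 1 \<le> R, so the estimate on the ball covers the
      first derivatives too.\<close>
    show "norm (spherical_factor n d b) \<le> 2 * R * (real n + real d)" if "b \<in> Basis" for b
      using n norm_Basis[OF that] R by (intro norm_spherical_factor_le) simp_all
  qed
  then have "bounded_derivs_at N ((2 ^ N) ^ k * (\<Prod>d<k. 2 * R * (real n + real d)))
      (\<lambda>x. \<Prod>d<k. spherical_factor n d x) x"
    by (rule bounded_derivs_at_prod[OF smooth_bounded_linear[OF bounded_linear_spherical_factor]])
  also have "(2 ^ N) ^ k * (\<Prod>d<k. 2 * R * (real n + real d)) = (2 ^ N * (2 * R)) ^ k * P"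
    by (simp add: P_def prod.distrib power_mult_distrib)
  finally have "bounded_derivs_at N
      (norm (inverse (pochhammer (of_nat n) k * fact k * 4 ^ k :: complex)) * ((2 ^ N * (2 * R)) ^ k * P))
      (spherical_coeff n k) x"
    unfolding spherical_coeff_def
    by (intro bounded_derivs_at_cmult smooth_prod smooth_bounded_linear bounded_linear_spherical_factor)
  then show ?thesis
  proof (rule bounded_derivs_at_mono)
    have "norm (inverse (pochhammer (of_nat n) k * fact k * 4 ^ k :: complex)) = inverse (P * fact k * 4 ^ k)"
      unfolding norm_inverse norm_mult poch by (simp add: norm_power)
    then have "norm (inverse (pochhammer (of_nat n) k * fact k * 4 ^ k :: complex)) * ((2 ^ N * (2 * R)) ^ k * P)
        = (2 ^ N * (2 * R)) ^ k / fact k / 4 ^ k"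
      using P by (simp add: divide_inverse)
    also have "\<dots> \<le> (2 ^ N * (2 * R)) ^ k / fact k / 1"
      using R by (intro divide_left_mono) simp_all
    finally show "norm (inverse (pochhammer (of_nat n) k * fact k * 4 ^ k :: complex)) * ((2 ^ N * (2 * R)) ^ k * P)
        \<le> (2 ^ N * (2 * R)) ^ k / fact k" by simp
  qed
qed

text \<open>The coefficient of \<zeta>^j s^k for \<open>p = (j, k)\<close>. The power \<lambda>^j is
  written as a product so that the bound for products applies to it.\<close>

definition spherical_term :: "nat \<Rightarrow> nat \<times> nat \<Rightarrow> real \<times> real \<Rightarrow> complex" where
  "spherical_term n p x = (inverse (fact (fst p)) * (\<Prod>d<fst p. of_real (snd x))) * spherical_coeff n (snd p) x"

lemma smooth_spherical_term: "smooth (spherical_term n p)"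
  unfolding spherical_term_def
  by (intro smooth_mult smooth_const smooth_prod smooth_spherical_coeff
      smooth_bounded_linear[OF bounded_linear_of_real_snd])

lemma bounded_derivs_at_spherical_term:
  assumes n: "1 \<le> n" and x: "norm x \<le> R" and R: "1 \<le> R"
  shows "bounded_derivs_at N (2 ^ N * exp_weight (2 ^ N * (2 * R)) p) (spherical_term n p) x"
proof -
  have snd: "norm (complex_of_real (snd y)) \<le> norm y" for y :: "real \<times> real"
    using norm_snd_le[of "snd y" "fst y"] by simp
  \<comment> \<open>The bound is relaxed from \<open>R\<close> to \<open>2 * R\<close> to give both
    indices the same base, as in \<open>exp_weight\<close>.\<close>
  have "bounded_derivs_at N (2 * R) (\<lambda>x. complex_of_real (snd x)) x"
  proof (rule bounded_derivs_at_linear[OF bounded_linear_of_real_snd])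
    show "norm (complex_of_real (snd x)) \<le> 2 * R" using snd[of x] x R by linarith
    show "norm (complex_of_real (snd b)) \<le> 2 * R" if "b \<in> Basis" for b :: "real \<times> real"
      using snd[of b] norm_Basis[OF that] R by linarith
  qed
  then have "bounded_derivs_at N ((2 ^ N) ^ fst p * (\<Prod>d<fst p. 2 * R))
      (\<lambda>x. \<Prod>d<fst p. complex_of_real (snd x)) x"
    by (rule bounded_derivs_at_prod[OF smooth_bounded_linear[OF bounded_linear_of_real_snd]])
  then have "bounded_derivs_at N (norm (inverse (fact (fst p)) :: complex) * ((2 ^ N) ^ fst p * (\<Prod>d<fst p. 2 * R)))
      (\<lambda>x. inverse (fact (fst p)) * (\<Prod>d<fst p. complex_of_real (snd x))) x"
    by (intro bounded_derivs_at_cmult smooth_prod smooth_bounded_linear[OF bounded_linear_of_real_snd])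
  also have "norm (inverse (fact (fst p)) :: complex) * ((2 ^ N) ^ fst p * (\<Prod>d<fst p. 2 * R))
      = (2 ^ N * (2 * R)) ^ fst p / fact (fst p)"
    by (simp add: norm_inverse power_mult_distrib divide_inverse mult_ac)
  finally show ?thesis
    unfolding spherical_term_def exp_weight_def
    by (intro bounded_derivs_at_mult bounded_derivs_at_spherical_coeff[OF n x R] smooth_spherical_coeff
        smooth_cmult smooth_prod smooth_bounded_linear[OF bounded_linear_of_real_snd])
qed

text \<open>The two exponentials merge into exp (\<lambda> \<zeta>), the bracket is a power series
  in s, and the product of two absolutely convergent series is a double series.\<close>

lemma spherical_eq_double_series:
  fixes z :: "complex ^ 'n"
  shows "spherical (of_real \<xi>) (of_real l) z t =
    double_series (\<lambda>i. spherical_term CARD('n) (prod_decode i) (\<xi>, l))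
      (\<i> * of_real t - of_real ((norm z)\<^sup>2) / 4, of_real ((norm z)\<^sup>2))"
proof -
  define s \<zeta> where "s = complex_of_real ((norm z)\<^sup>2)" and "\<zeta> = \<i> * of_real t - s / 4"
  define a where "a j = \<zeta> ^ j * (inverse (fact j) * of_real l ^ j)" for j
  define b where "b k = s ^ k * spherical_coeff CARD('n) k (\<xi>, l)" for k
  have aexp: "a = (\<lambda>j. (of_real l * \<zeta>) ^ j /\<^sub>R fact j)"
    by (simp add: a_def fun_eq_iff scaleR_conv_of_real power_mult_distrib mult_ac)
  have sa: "summable (\<lambda>j. norm (a j))"
    unfolding aexp by (rule summable_norm_exp)
  have suma: "suminf a = exp (\<i> * of_real l * of_real t) * exp (- of_real l * of_real ((norm z)\<^sup>2) / 4)"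
    unfolding aexp exp_def[symmetric] exp_add[symmetric]
    by (simp add: sums_unique[OF exp_converges, symmetric] \<zeta>_def s_def algebra_simps)
  define R where "R = norm (\<xi>, l) + 1"
  have R: "norm (\<xi>, l) \<le> R" "1 \<le> R" by (simp_all add: R_def)
  have bk: "norm (b k) \<le> (norm s * (2 * R)) ^ k / fact k" for k
  proof -
    \<comment> \<open>The case \<open>N = 0\<close> of the derivative bounds is a bound on the
      values.\<close>
    have "norm (spherical_coeff CARD('n) k (\<xi>, l)) \<le> (2 ^ 0 * (2 * R)) ^ k / fact k"
      by (rule bounded_derivs_at_norm_le[OF bounded_derivs_at_spherical_coeff[OF _ R]]) simp
    then have "norm s ^ k * norm (spherical_coeff CARD('n) k (\<xi>, l)) \<le> norm s ^ k * ((2 * R) ^ k / fact k)"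
      by (intro mult_left_mono) simp_all
    then show ?thesis by (simp add: b_def norm_mult norm_power power_mult_distrib)
  qed
  have sb: "summable (\<lambda>k. norm (b k))"
    by (rule summable_comparison_test'[OF summable_power_div_fact]) (use bk in simp)
  have bS: "b k = of_real (norm z ^ (2 * k)) / (pochhammer (of_nat CARD('n)) k * fact k * 4 ^ k) *
        (\<Prod>d = 0..k - 1. (of_real l * of_nat (2 * d + CARD('n)) - of_real \<xi>))" if "k \<in> {1..}" for k
  proof -
    have "{0..k - 1} = {..<k}" using that by auto
    moreover have "s ^ k = of_real (norm z ^ (2 * k))" by (simp add: s_def power_mult)
    ultimately show ?thesis
      by (simp add: b_def spherical_coeff_def spherical_factor_def divide_inverse mult_ac)
  qed
  have b0: "b 0 = 1" by (simp add: b_def spherical_coeff_def)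
  \<comment> \<open>The sum in \<open>spherical\<close> starts at 1; splitting off
    \<open>b 0 = 1\<close> accounts for its leading summand.\<close>
  have "b summable_on UNIV" using sb by (rule norm_summable_imp_summable_on)
  then have "b summable_on {1..}" by (rule summable_on_subset_banach) simp
  then have "infsum b (insert 0 {1..}) = b 0 + infsum b {1..}"
    by (subst infsum_insert) simp_all
  also have "insert 0 {1..} = (UNIV :: nat set)" by auto
  finally have "suminf b = 1 + infsum b {1..}"
    by (simp add: summable_norm_imp_infsum[OF sb] b0)
  also have "infsum b {1..} = (\<Sum>\<^sub>\<infinity>k\<in>{1..}.
        of_real (norm z ^ (2 * k)) / (pochhammer (of_nat CARD('n)) k * fact k * 4 ^ k) *
        (\<Prod>d = 0..k - 1. (of_real l * of_nat (2 * d + CARD('n)) - of_real \<xi>)))"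
    using bS by (rule infsum_cong)
  finally have "spherical (of_real \<xi>) (of_real l) z t = suminf a * suminf b"
    by (simp add: spherical_def suma)
  also have "\<dots> = (\<Sum>i. a (fst (prod_decode i)) * b (snd (prod_decode i)))"
    by (rule sums_unique[OF sums_prod_decode(1)[OF sa sb]])
  also have "\<dots> = double_series (\<lambda>i. spherical_term CARD('n) (prod_decode i) (\<xi>, l)) (\<zeta>, s)"
    unfolding double_series_def
    by (rule suminf_cong) (simp add: a_def b_def spherical_term_def mult_ac)
  finally show ?thesis by (simp only: \<zeta>_def s_def)
qed

section \<open>Pairing with the spherical functions\<close>

text \<open>Inside the ball the Leibniz bound applies, outside the product vanishes. It matters that
  \<open>K\<close> does not depend on \<open>p\<close>.\<close>

lemma cutoff_spherical_term_bounds: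
  assumes n: "1 \<le> n" and R: "1 \<le> R"
    and \<eta>: "smooth \<eta>" "\<And>x. R < norm x \<Longrightarrow> \<eta> x = 0"
  shows "\<exists>K\<ge>0. \<forall>p.
    bounded_derivs N (K * exp_weight (2 ^ N * (2 * R)) p) (\<lambda>x. \<eta> x * spherical_term n p x)"
proof -
  have "\<exists>M\<ge>0. bounded_derivs N M \<eta>"
    using \<eta> by (rule bounded_derivs_exists)
  then obtain M where M: "0 \<le> M" "bounded_derivs N M \<eta>"
    by (elim exE conjE)
  \<comment> \<open>One \<open>2 ^ N\<close> comes from the product with the cutoff, the other from
    the two factors of \<open>spherical_term\<close>.\<close>
  define K where "K = 2 ^ N * (M * 2 ^ N)"
  have K: "0 \<le> K" using M by (simp add: K_def)
  have "bounded_derivs N (K * exp_weight (2 ^ N * (2 * R)) p) (\<lambda>x. \<eta> x * spherical_term n p x)" for p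
    unfolding bounded_derivs_def
  proof (intro allI impI)
    fix bs :: "(real \<times> real) list" and x assume l: "length bs \<le> N" and bs: "set bs \<subseteq> Basis"
    show "norm (iter_deriv bs (\<lambda>x. \<eta> x * spherical_term n p x) x) \<le> K * exp_weight (2 ^ N * (2 * R)) p"
    proof (cases "R < norm x")
      case True
      have "iter_deriv bs (\<lambda>x. \<eta> x * spherical_term n p x) x = 0"
        using _ True by (rule iter_deriv_eq_0_outside) (simp add: \<eta>(2))
      then show ?thesis using K R by (simp add: exp_weight_nonneg)
    next
      case False
      then have x: "norm x \<le> R" by simp
      have "bounded_derivs_at N M \<eta> x"
        unfolding bounded_derivs_at_def by (intro allI impI bounded_derivsD[OF M(2)])
      from bounded_derivs_at_mult[OF \<eta>(1) smooth_spherical_term this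
          bounded_derivs_at_spherical_term[OF n x R, of N p]]
      have "norm (iter_deriv bs (\<lambda>x. \<eta> x * spherical_term n p x) x)
          \<le> 2 ^ N * (M * (2 ^ N * exp_weight (2 ^ N * (2 * R)) p))"
        using l bs by (rule bounded_derivs_atD)
      then show ?thesis by (simp add: K_def mult_ac)
    qed
  qed
  with K show ?thesis by (intro exI[of _ K] conjI allI)
qed

lemma summable_double_series_spherical_term:
  assumes "1 \<le> n"
  shows "summable (\<lambda>i. \<zeta> ^ fst (prod_decode i) * s ^ snd (prod_decode i) * spherical_term n (prod_decode i) x)"
proof -
  define R where "R = norm x + 1"
  have R: "norm x \<le> R" "1 \<le> R" by (simp_all add: R_def)
  define r where "r = max (norm \<zeta>) (norm s)"
  have r: "norm \<zeta> \<le> r" "norm s \<le> r" "0 \<le> r" by (simp_all add: r_def le_max_iff_disj)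
  show ?thesis
  proof (rule summable_comparison_test'[OF summable_exp_weight])
    show "0 \<le> r * (2 * R)" using r R by simp
    fix i
    let ?p = "prod_decode i"
    have "norm (spherical_term n ?p x) \<le> 2 ^ 0 * exp_weight (2 ^ 0 * (2 * R)) ?p"
      by (rule bounded_derivs_at_norm_le[OF bounded_derivs_at_spherical_term[OF assms R]])
    then have "norm (\<zeta> ^ fst ?p * s ^ snd ?p * spherical_term n ?p x)
        \<le> norm (\<zeta> ^ fst ?p * s ^ snd ?p) * exp_weight (2 * R) ?p"
      unfolding norm_mult[of _ "spherical_term n ?p x"] by (intro mult_left_mono) simp_all
    also have "\<dots> \<le> exp_weight (r * (2 * R)) ?p"
      using r R by (intro norm_power_mult_exp_weight_le) simp_all
    finally show "norm (\<zeta> ^ fst ?p * s ^ snd ?p * spherical_term n ?p x) \<le> exp_weight (r * (2 * R)) ?p" .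
  qed
qed

text \<open>For fixed \<zeta> and s the monomials are scalars, so once the sum is moved out of
  \<open>U\<close>, homogeneity leaves numerical coefficients.\<close>

lemma distribution_double_series:
  assumes U: "tempered_distribution U" and n: "1 \<le> n" and R: "1 \<le> R"
    and \<eta>: "smooth \<eta>" "\<And>x. R < norm x \<Longrightarrow> \<eta> x = 0"
  shows "U (\<lambda>x. \<eta> x * double_series (\<lambda>i. spherical_term n (prod_decode i) x) (\<zeta>, s)) =
    double_series (\<lambda>i. U (\<lambda>x. \<eta> x * spherical_term n (prod_decode i) x)) (\<zeta>, s)"
proof -
  define u where "u i = \<zeta> ^ fst (prod_decode i) * s ^ snd (prod_decode i)" for i
  define \<psi> where "\<psi> i x = \<eta> x * spherical_term n (prod_decode i) x" for i x
  have \<psi>: "smooth (\<psi> i)" "\<And>x. R < norm x \<Longrightarrow> \<psi> i x = 0" for i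
    unfolding \<psi>_def using \<eta> by (simp_all add: smooth_mult smooth_spherical_term)
  have \<psi>_schwartz: "\<psi> i \<in> schwartz" for i
    using \<psi> R by (rule schwartz_compact_support)
  define r where "r = max (norm \<zeta>) (norm s)"
  have r: "norm \<zeta> \<le> r" "norm s \<le> r" "0 \<le> r" by (simp_all add: r_def le_max_iff_disj)
  have bd: "\<exists>M. summable M \<and> (\<forall>i. bounded_derivs N (M i) (\<lambda>x. u i * \<psi> i x))" for N
  proof -
    define A where "A = 2 ^ N * (2 * R)"
    have A: "0 \<le> A" using R by (simp add: A_def)
    have "\<exists>K\<ge>0. \<forall>p. bounded_derivs N (K * exp_weight A p) (\<lambda>x. \<eta> x * spherical_term n p x)"
      unfolding A_def by (rule cutoff_spherical_term_bounds[OF n R \<eta>])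
    then obtain K where K: "0 \<le> K"
      "\<forall>p. bounded_derivs N (K * exp_weight A p) (\<lambda>x. \<eta> x * spherical_term n p x)"
      by (elim exE conjE)
    \<comment> \<open>The monomial is at most r^(j + k), which only changes the base of the weight
      to \<open>r * A\<close>.\<close>
    have "bounded_derivs N (K * exp_weight (r * A) (prod_decode i)) (\<lambda>x. u i * \<psi> i x)" for i
      unfolding bounded_derivs_def
    proof (intro allI impI)
      fix bs :: "(real \<times> real) list" and x assume l: "length bs \<le> N" and bs: "set bs \<subseteq> Basis"
      have "norm (iter_deriv bs (\<lambda>x. u i * \<psi> i x) x) = norm (u i) * norm (iter_deriv bs (\<psi> i) x)"
        by (simp add: iter_deriv_cmult[OF \<psi>(1) bs] norm_mult)
      also have "\<dots> \<le> norm (u i) * (K * exp_weight A (prod_decode i))"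
        unfolding \<psi>_def by (intro mult_left_mono bounded_derivsD[OF spec[OF K(2)] l bs] norm_ge_zero)
      also have "\<dots> = K * (norm (u i) * exp_weight A (prod_decode i))" by simp
      also have "\<dots> \<le> K * exp_weight (r * A) (prod_decode i)"
        unfolding u_def by (intro mult_left_mono norm_power_mult_exp_weight_le r A K)
      finally show "norm (iter_deriv bs (\<lambda>x. u i * \<psi> i x) x) \<le> K * exp_weight (r * A) (prod_decode i)" .
    qed
    moreover have "summable (\<lambda>i. K * exp_weight (r * A) (prod_decode i))"
      using r A by (intro summable_mult summable_exp_weight) simp
    ultimately show ?thesis
      by (intro exI[of _ "\<lambda>i. K * exp_weight (r * A) (prod_decode i)"]) simp
  qed
  have "(\<lambda>i. U (\<lambda>x. u i * \<psi> i x)) sums U (\<lambda>x. \<Sum>i. u i * \<psi> i x)"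
    by (rule tempered_distribution_sums[OF U R _ bd]) (simp_all add: \<psi> smooth_cmult)
  moreover have "U (\<lambda>x. u i * \<psi> i x) = u i * U (\<psi> i)" for i
    using U \<psi>_schwartz[of i] unfolding tempered_distribution_def by blast
  ultimately have "U (\<lambda>x. \<Sum>i. u i * \<psi> i x) = (\<Sum>i. u i * U (\<psi> i))"
    by (simp add: sums_iff)
  moreover have "(\<Sum>i. u i * \<psi> i x) = \<eta> x * double_series (\<lambda>i. spherical_term n (prod_decode i) x) (\<zeta>, s)" for x
  proof -
    have "(\<Sum>i. u i * \<psi> i x) = (\<Sum>i. \<eta> x * (u i * spherical_term n (prod_decode i) x))"
      by (simp add: \<psi>_def mult_ac)
    also have "\<dots> = \<eta> x * (\<Sum>i. u i * spherical_term n (prod_decode i) x)"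
      unfolding u_def by (rule suminf_mult[OF summable_double_series_spherical_term[OF n]])
    finally show ?thesis by (simp add: double_series_def u_def)
  qed
  ultimately show ?thesis by (simp add: double_series_def u_def \<psi>_def[abs_def])
qed

text \<open>Squares without complex conjugation: this is the polynomial, hence holomorphic,
  extension of the squared norm of x + i y from real x and y.\<close>

definition complex_square_sum :: "(complex ^ 'n) \<times> (complex ^ 'n) \<times> complex \<Rightarrow> complex" where
  "complex_square_sum p = (\<Sum>j\<in>UNIV. fst p $ j * fst p $ j + fst (snd p) $ j * fst (snd p) $ j)"

lemma complex_square_sum_of_real:
  fixes x y :: "real ^ 'n"
  shows "complex_square_sum (\<chi> j. of_real (x $ j), \<chi> j. of_real (y $ j), w) =
    of_real ((norm (\<chi> j. complex_of_real (x $ j) + \<i> * of_real (y $ j)))\<^sup>2)"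
proof -
  have "(norm (\<chi> j. complex_of_real (x $ j) + \<i> * of_real (y $ j)))\<^sup>2 = (\<Sum>j\<in>UNIV. (x $ j)\<^sup>2 + (y $ j)\<^sup>2)"
    by (simp add: norm_vec_def L2_set_def sum_nonneg cmod_power2)
  then show ?thesis
    by (simp add: complex_square_sum_def power2_eq_square)
qed

lemma complex_square_sum_has_derivative:
  fixes p :: "(complex ^ 'n) \<times> (complex ^ 'n) \<times> complex"
  shows "(complex_square_sum has_derivative (\<lambda>h. \<Sum>j\<in>UNIV.
      (fst p $ j * fst h $ j + fst h $ j * fst p $ j)
      + (fst (snd p) $ j * fst (snd h) $ j + fst (snd h) $ j * fst (snd p) $ j))) (at p)"
  unfolding complex_square_sum_def
  by (intro has_derivative_sum has_derivative_add has_derivative_mult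
      bounded_linear_imp_has_derivative bounded_linear_compose[OF bounded_linear_vec_nth]
      bounded_linear_compose[OF bounded_linear_fst] bounded_linear_fst bounded_linear_snd)

text \<open>The chain rule, applied to polynomial inner functions; the complex homogeneity of the
  two derivatives survives their composition.\<close>

lemma entire_double_series:
  fixes c :: "nat \<Rightarrow> complex"
  assumes "\<And>i. norm (c i) \<le> K * exp_weight A (prod_decode i)" "0 \<le> K" "0 \<le> A"
  shows "entire (\<lambda>p::(complex ^ 'n) \<times> (complex ^ 'n) \<times> complex.
    double_series c (\<i> * snd (snd p) - complex_square_sum p / 4, complex_square_sum p))"
  unfolding entire_def
proof
  fix p :: "(complex ^ 'n) \<times> (complex ^ 'n) \<times> complex"
  let ?q = "\<lambda>p. (\<i> * snd (snd p) - complex_square_sum p / 4, complex_square_sum p)"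
  define S where "S h = (\<Sum>j\<in>UNIV.
      (fst p $ j * fst h $ j + fst h $ j * fst p $ j)
      + (fst (snd p) $ j * fst (snd h) $ j + fst (snd h) $ j * fst (snd p) $ j))"
    for h :: "(complex ^ 'n) \<times> (complex ^ 'n) \<times> complex"
  have S: "(complex_square_sum has_derivative S) (at p)"
    unfolding S_def by (rule complex_square_sum_has_derivative)
  have S_scale: "S (e *s u, e *s v, e * w) = e * S (u, v, w)" for e u v w
    unfolding S_def sum_distrib_left by (rule sum.cong) (simp_all add: algebra_simps)
  have q: "(?q has_derivative (\<lambda>h. (\<i> * snd (snd h) - S h / 4, S h))) (at p)"
    by (intro has_derivative_Pair has_derivative_diff S
        bounded_linear.has_derivative[OF bounded_linear_divide S]
        bounded_linear_imp_has_derivative bounded_linear_compose[OF bounded_linear_mult_right]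
        bounded_linear_compose[OF bounded_linear_snd] bounded_linear_snd bounded_linear_ident)
  obtain D where D: "(double_series c has_derivative D) (at (?q p))"
      and D_scale: "\<forall>e u v. D (e * u, e * v) = e * D (u, v)"
    using double_series_differentiable[OF assms, of "?q p"] by (elim exE conjE)
  let ?D = "\<lambda>h. D (\<i> * snd (snd h) - S h / 4, S h)"
  have "((\<lambda>p. double_series c (?q p)) has_derivative ?D) (at p)"
    by (rule has_derivative_compose[OF q D])
  moreover have "?D (e *s u, e *s v, e * w) = e * ?D (u, v, w)" for e u v w
  proof -
    have "\<i> * (e * w) - e * S (u, v, w) / 4 = e * (\<i> * w - S (u, v, w) / 4)"
      by (simp add: algebra_simps)
    then show ?thesis using D_scale by (simp add: S_scale)
  qed
  ultimately show "\<exists>D. ((\<lambda>p. double_series c (?q p)) has_derivative D) (at p) \<and>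
      (\<forall>e u v w. D (e *s u, e *s v, e * w) = e * D (u, v, w))"
    by (intro exI[of _ ?D]) simp
qed

theorem lemma8p1:
  fixes U :: "(real \<times> real \<Rightarrow> complex) \<Rightarrow> complex"
  assumes "tempered_distribution U"
    and "compact (dist_support U)"
  shows "\<exists>F :: (complex ^ 'n) \<times> (complex ^ 'n) \<times> complex \<Rightarrow> complex.
    entire F \<and>
    (\<forall>(x :: real ^ 'n) (y :: real ^ 'n) (t :: real).
       F (\<chi> j. of_real (x $ j), \<chi> j. of_real (y $ j), of_real t) =
       f_U U (\<chi> j. of_real (x $ j) + \<i> * of_real (y $ j)) t)"
proof -
  \<comment> \<open>The same choice as in \<open>pairing\<close>, so that \<open>f_U\<close> unfolds
    to \<open>U\<close> applied to a product with this cutoff.\<close>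
  define \<eta> where "\<eta> = (SOME \<eta>. cutoff_for (dist_support U) \<eta>)"
  have "cutoff_for (dist_support U) \<eta>"
    unfolding \<eta>_def using cutoff_for_exists[OF assms(2)] by (rule someI_ex)
  then have \<eta>: "smooth \<eta>" and cpt: "compact (closure {x. \<eta> x \<noteq> 0})"
    by (simp_all add: cutoff_for_def test_function_def)
  obtain R0 where R0: "\<forall>x\<in>closure {x. \<eta> x \<noteq> 0}. norm x \<le> R0"
    using compact_imp_bounded[OF cpt] unfolding bounded_iff by (elim exE)
  define R where "R = max 1 R0"
  have R: "1 \<le> R" by (simp add: R_def)
  have \<eta>0: "\<eta> x = 0" if "R < norm x" for x
  proof (rule ccontr)
    assume "\<eta> x \<noteq> 0"
    then have "x \<in> closure {x. \<eta> x \<noteq> 0}" using closure_subset by fastforce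
    then show False using bspec[OF R0, of x] that by (simp add: R_def)
  qed
  define c where "c i = U (\<lambda>x. \<eta> x * spherical_term CARD('n) (prod_decode i) x)" for i
  have n: "1 \<le> CARD('n)" by simp
  obtain N C where C: "0 \<le> C"
    "\<And>g M. smooth g \<Longrightarrow> (\<And>x. R < norm x \<Longrightarrow> g x = 0) \<Longrightarrow> 0 \<le> M \<Longrightarrow> bounded_derivs N M g \<Longrightarrow>
       norm (U g) \<le> C * M"
    by (rule tempered_distribution_bound[OF assms(1) R]) blast
  \<comment> \<open>\<open>N\<close> depends on \<open>U\<close> and \<open>R\<close> alone, so one
    \<open>A\<close> serves the coefficients of all indices.\<close>
  define A where "A = 2 ^ N * (2 * R)"
  have A: "0 \<le> A" using R by (simp add: A_def)
  have "\<exists>K\<ge>0. \<forall>p. bounded_derivs N (K * exp_weight A p) (\<lambda>x. \<eta> x * spherical_term CARD('n) p x)"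
    unfolding A_def by (rule cutoff_spherical_term_bounds[OF n R \<eta> \<eta>0])
  then obtain K where K: "0 \<le> K"
    "\<forall>p. bounded_derivs N (K * exp_weight A p) (\<lambda>x. \<eta> x * spherical_term CARD('n) p x)"
    by (elim exE conjE)
  have c: "norm (c i) \<le> (C * K) * exp_weight A (prod_decode i)" for i
  proof -
    have "norm (c i) \<le> C * (K * exp_weight A (prod_decode i))"
      unfolding c_def
    proof (rule C(2)[OF _ _ _ spec[OF K(2)]])
      show "smooth (\<lambda>x. \<eta> x * spherical_term CARD('n) (prod_decode i) x)"
        by (intro smooth_mult \<eta> smooth_spherical_term)
      show "\<eta> x * spherical_term CARD('n) (prod_decode i) x = 0" if "R < norm x" for x
        by (simp add: \<eta>0[OF that])
      show "0 \<le> K * exp_weight A (prod_decode i)"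
        using K(1) A by (simp add: exp_weight_nonneg)
    qed
    then show ?thesis by simp
  qed
  define F :: "(complex ^ 'n) \<times> (complex ^ 'n) \<times> complex \<Rightarrow> complex"
    where "F p = double_series c (\<i> * snd (snd p) - complex_square_sum p / 4, complex_square_sum p)" for p
  have "entire F"
    unfolding F_def using c _ A by (rule entire_double_series) (simp add: C(1) K(1))
  moreover have "F (\<chi> j. of_real (x $ j), \<chi> j. of_real (y $ j), of_real t) =
      f_U U (\<chi> j. of_real (x $ j) + \<i> * of_real (y $ j)) t" for x y :: "real ^ 'n" and t
  proof -
    let ?z = "\<chi> j. complex_of_real (x $ j) + \<i> * of_real (y $ j)"
    let ?q = "(\<i> * of_real t - of_real ((norm ?z)\<^sup>2) / 4, of_real ((norm ?z)\<^sup>2))"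
    have "f_U U ?z t = U (\<lambda>x. \<eta> x * (case x of (\<xi>, l) \<Rightarrow> spherical (of_real \<xi>) (of_real l) ?z t))"
      by (simp only: f_U_def pairing_def Let_def \<eta>_def)
    also have "\<dots> = U (\<lambda>x. \<eta> x * double_series (\<lambda>i. spherical_term CARD('n) (prod_decode i) x) ?q)"
      by (simp only: spherical_eq_double_series case_prod_unfold prod.collapse)
    also have "\<dots> = double_series c ?q"
      unfolding c_def by (rule distribution_double_series[OF assms(1) n R \<eta> \<eta>0])
    also have "\<dots> = F (\<chi> j. of_real (x $ j), \<chi> j. of_real (y $ j), of_real t)"
      by (simp only: F_def complex_square_sum_of_real snd_conv)
    finally show ?thesis by (rule sym)
  qed
  ultimately show ?thesis by (intro exI[of _ F]) simp
qed

end
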